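(* Let $G(\mathbb Z)=\mathbb Z\times H_3(\mathbb Z)$, let $\rho_1$ be the left-invariant word metric on $G(\mathbb Z)$ associated to the finite generating set $$S_1=\{(1;0,0,1)^{\pm1},(1;0,0,-1)^{\pm1},(0;1,0,0)^{\pm1},(0;0,1,0)^{\pm1}\},$$ and let $X^1_n=(B_{\rho_1}(\mathrm{id},n),\frac1n\rho_1)$ and $X_\infty=(B_{d_\infty}(\mathrm{id},1),d_\infty)$, where $d_\infty$ is the Pansu limit metric on $\mathbb R\times H_3(\mathbb R)$ associated to $\rho_1$. Then there is $c>0$ such that for all integers $n\ge1$, $$d_{GH}(X^1_n,X_\infty)>\frac{c}{\sqrt n}.$$
   Context: $H_3(\mathbb R)$ is the 3-dimensional Heisenberg group; its Lie algebra has a basis $X,Y,Z$ with $[X,Y]=Z$, $Z$ central. An element of $\mathbb R\times H_3(\mathbb R)$ is written $(v;x,y,z)$, meaning $(v,\exp(xX+yY+zZ))$; thus $(v;x,y,z)(v';x',y',z')=(v+v';x+x',y+y',z+z'+\frac12(xy'-yx'))$. $H_3(\mathbb Z)$ is the subgroup of $H_3(\mathbb R)$ generated by $\exp X$ and $\exp Y$. The word metric $\rho_1$ is the left-invariant metric for which $\rho_1(\mathrm{id},\gamma)$ is the least length of a word in $S_1$ representing $\gamma$. $d_3$ is the left-invariant subFinsler metric on $H_3(\mathbb R)$ associated to the $\ell^1$ norm $\|xX+yY\|=|x|+|y|$ on $\mathbb RX\oplus\mathbb RY$: $d_3(p,q)$ is the infimum of the lengths of paths from $p$ to $q$ that are finite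 concatenations of left translates of segments $\{\exp(tW)\}_{t\in[0,T]}$, $W\in\mathbb RX\oplus\mathbb RY$, such a segment having length $T\|W\|$. The Pansu limit metric $d_\infty$ here is the left-invariant metric on $\mathbb R\times H_3(\mathbb R)$ with $d_\infty(\mathrm{id},(t,g))=|t|+d_3(\mathrm{id},g)$. Balls $B(\mathrm{id},\cdot)$ are closed balls. The Gromov-Hausdorff distance between compact metric spaces is $d_{GH}(X,Y)=\inf\{d_{\mathrm{Haus},Z}(X,Y)\}$, the infimum being over all metrics on the disjoint union $Z=X\sqcup Y$ that restrict to $d_X$ on $X$ and to $d_Y$ on $Y$. *)

theory Defs
  imports "HOL-Analysis.Analysis" "HOL-Algebra.Algebra"
begin

section \<open>The groups\<close>

text \<open>
  The triple \<open>(x, y, z)\<close> stands for \<open>exp (x X + y Y + z Z)\<close>, so in these coordinates the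
  exponential map is the identity; the product is the Baker--Campbell--Hausdorff formula
  for \<open>[X, Y] = Z\<close> with \<open>Z\<close> central.
\<close>

definition heisenberg :: "(real \<times> real \<times> real) monoid" where
  "heisenberg = \<lparr>carrier = UNIV,
     mult = (\<lambda>(x, y, z) (x', y', z'). (x + x', y + y', z + z' + (x * y' - y * x') / 2)),
     one = (0, 0, 0)\<rparr>"

definition real_add_group :: "real monoid" where
  "real_add_group = \<lparr>carrier = UNIV, mult = (+), one = 0\<rparr>"

definition RH3 :: "(real \<times> real \<times> real \<times> real) monoid" where
  "RH3 = real_add_group \<times>\<times> heisenberg"

definition heisenberg_int :: "(real \<times> real \<times> real) set" where
  "heisenberg_int = generate heisenberg {(1, 0, 0), (0, 1, 0)}"

definition GZ :: "(real \<times> real \<times> real \<times> real) set" where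
  "GZ = \<int> \<times> heisenberg_int"

lemma heisenberg_mult [simp]:
  "(x, y, z) \<otimes>\<^bsub>heisenberg\<^esub> (x', y', z') = (x + x', y + y', z + z' + (x * y' - y * x') / 2)"
  by (simp add: heisenberg_def)

lemma RH3_mult [simp]:
  "(v, x, y, z) \<otimes>\<^bsub>RH3\<^esub> (v', x', y', z') =
     (v + v', x + x', y + y', z + z' + (x * y' - y * x') / 2)"
  by (simp add: RH3_def real_add_group_def)

lemma carriers [simp]:
  "carrier heisenberg = UNIV" "carrier real_add_group = UNIV" "carrier RH3 = UNIV"
  by (simp_all add: heisenberg_def real_add_group_def RH3_def)

lemma ones [simp]: "\<one>\<^bsub>heisenberg\<^esub> = (0, 0, 0)" "\<one>\<^bsub>RH3\<^esub> = (0, 0, 0, 0)"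
  by (simp_all add: heisenberg_def real_add_group_def RH3_def)

lemma group_heisenberg: "group heisenberg"
proof (rule groupI)
  fix p assume "p \<in> carrier heisenberg"
  obtain x y z where "p = (x, y, z)" by (cases p)
  then have "(-x, -y, -z) \<otimes>\<^bsub>heisenberg\<^esub> p = \<one>\<^bsub>heisenberg\<^esub>" by simp
  then show "\<exists>q\<in>carrier heisenberg. q \<otimes>\<^bsub>heisenberg\<^esub> p = \<one>\<^bsub>heisenberg\<^esub>"
    unfolding carriers by blast
qed (auto simp: field_simps)

lemma group_real_add_group: "group real_add_group"
  by (rule groupI) (auto simp: real_add_group_def intro: exI [of _ "- x" for x])

lemma group_RH3: "group RH3"
  unfolding RH3_def by (rule DirProd_group [OF group_real_add_group group_heisenberg])

lemma heisenberg_inv [simp]: "inv\<^bsub>heisenberg\<^esub> (x, y, z) = (-x, -y, -z)"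
  by (rule group.inv_equality [OF group_heisenberg]) auto

lemma RH3_inv [simp]: "inv\<^bsub>RH3\<^esub> (v, x, y, z) = (-v, -x, -y, -z)"
  by (rule group.inv_equality [OF group_RH3]) auto


section \<open>Word metrics\<close>

definition word_length :: "('a, 'b) monoid_scheme \<Rightarrow> 'a set \<Rightarrow> 'a \<Rightarrow> nat" where
  "word_length G S g =
     (LEAST k. \<exists>w. length w = k \<and> set w \<subseteq> S \<and> foldr (\<otimes>\<^bsub>G\<^esub>) w \<one>\<^bsub>G\<^esub> = g)"

definition word_metric :: "('a, 'b) monoid_scheme \<Rightarrow> 'a set \<Rightarrow> 'a \<Rightarrow> 'a \<Rightarrow> real" where
  "word_metric G S g h = real (word_length G S (inv\<^bsub>G\<^esub> g \<otimes>\<^bsub>G\<^esub> h))"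

definition S1 :: "(real \<times> real \<times> real \<times> real) set" where
  "S1 = (let T = {(1, 0, 0, 1), (1, 0, 0, -1), (0, 1, 0, 0), (0, 0, 1, 0)}
         in T \<union> (\<lambda>s. inv\<^bsub>RH3\<^esub> s) ` T)"

definition rho1 :: "real \<times> real \<times> real \<times> real \<Rightarrow> real \<times> real \<times> real \<times> real \<Rightarrow> real" where
  "rho1 = word_metric RH3 S1"

definition rho1_ball :: "nat \<Rightarrow> (real \<times> real \<times> real \<times> real) set" where
  "rho1_ball n = {g \<in> GZ. rho1 \<one>\<^bsub>RH3\<^esub> g \<le> real n}"


section \<open>The subFinsler metric and the limit metric\<close>

text \<open>
  \<open>horizontal_path p q L\<close>: some finite concatenation of left translates of segments
  \<open>t \<mapsto> exp (t W)\<close>, \<open>t \<in> [0, T]\<close>, \<open>W = a X + b Y\<close>, leads from \<open>p\<close> to \<open>q\<close> and has length \<open>L\<close>.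
  The translate starting at \<open>q\<close> ends at \<open>q exp (T W)\<close>.
\<close>

inductive horizontal_path ::
  "real \<times> real \<times> real \<Rightarrow> real \<times> real \<times> real \<Rightarrow> real \<Rightarrow> bool" for p where
  trivial: "horizontal_path p p 0"
| segment: "horizontal_path p q L \<Longrightarrow> 0 \<le> T \<Longrightarrow>
    horizontal_path p (q \<otimes>\<^bsub>heisenberg\<^esub> (T * a, T * b, 0)) (L + T * (\<bar>a\<bar> + \<bar>b\<bar>))"

definition d3 :: "real \<times> real \<times> real \<Rightarrow> real \<times> real \<times> real \<Rightarrow> real" where
  "d3 p q = Inf {L. horizontal_path p q L}"

definition d_inf :: "real \<times> real \<times> real \<times> real \<Rightarrow> real \<times> real \<times> real \<times> real \<Rightarrow> real" where
  "d_inf p q = (case inv\<^bsub>RH3\<^esub> p \<otimes>\<^bsub>RH3\<^esub> q of (t, g) \<Rightarrow> \<bar>t\<bar> + d3 \<one>\<^bsub>heisenberg\<^esub> g)"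

definition d_inf_ball :: "real \<Rightarrow> (real \<times> real \<times> real \<times> real) set" where
  "d_inf_ball r = {p. d_inf \<one>\<^bsub>RH3\<^esub> p \<le> r}"


section \<open>Gromov--Hausdorff distance\<close>

text \<open>
  Both distances are real valued, hence meaningful only for nonempty bounded sets.
\<close>

definition hausdorff_distance :: "('a \<Rightarrow> 'a \<Rightarrow> real) \<Rightarrow> 'a set \<Rightarrow> 'a set \<Rightarrow> real" where
  "hausdorff_distance d A B =
     max (SUP a\<in>A. INF b\<in>B. d a b) (SUP b\<in>B. INF a\<in>A. d a b)"

definition gh_distance ::
  "'a set \<Rightarrow> ('a \<Rightarrow> 'a \<Rightarrow> real) \<Rightarrow> 'b set \<Rightarrow> ('b \<Rightarrow> 'b \<Rightarrow> real) \<Rightarrow> real" where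
  "gh_distance A dA B dB = Inf {hausdorff_distance d (Inl ` A) (Inr ` B) | d.
     Metric_space (A <+> B) d \<and>
     (\<forall>a\<in>A. \<forall>a'\<in>A. d (Inl a) (Inl a') = dA a a') \<and>
     (\<forall>b\<in>B. \<forall>b'\<in>B. d (Inr b) (Inr b') = dB b b')}"

end

theory Submission
  imports Defs
begin

text \<open>
  In \<open>X\<^sub>n\<close> the four poles \<open>(\<plusminus>n; 0, 0, \<plusminus>n)\<close> form two antipodal pairs \<open>(-n; 0, 0, -cn), (n; 0, 0, cn)\<close>,
  \<open>c = \<plusminus>1\<close>, at distance \<open>2 n\<close>. For each pair the central coordinate is the largest possible at that
  distance, which leaves no freedom for the midpoint: every \<open>D\<close>-approximate midpoint is within
  \<open>O(D)\<close> of the identity. In \<open>X\<^sub>\<infinity>\<close> only pairs close to \<open>(\<plusminus>1; id)\<close> have this property. Indeed, if both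
  factors contribute to a pair then its geodesics can be traversed in different orders, and if the
  pair lies in the Heisenberg factor then a central displacement of the midpoint by \<open>\<epsilon>\<close> lengthens
  the path by \<open>O(\<epsilon>)\<close> only, while moving the midpoint by about \<open>\<surd>\<epsilon>\<close>. So an \<open>\<epsilon>\<close>-correspondence sends
  both poles \<open>(n; 0, 0, \<plusminus>n)\<close> to within \<open>O(\<epsilon>)\<close> of one and the same point of the axis, although
  their distance in \<open>X\<^sub>n\<close> is at least \<open>1 / \<surd>n\<close>.
\<close>

section \<open>The word metric\<close>

text \<open>The length is exact so that lengths add under products. \<open>word_length\<close> is
  the least such \<open>k\<close>, and carries information only where some \<open>k\<close>
  exists.\<close>

definition word_reach :: "('a, 'b) monoid_scheme \<Rightarrow> 'a set \<Rightarrow> nat \<Rightarrow> 'a \<Rightarrow> bool" where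
  "word_reach G S k g \<longleftrightarrow> (\<exists>w. length w = k \<and> set w \<subseteq> S \<and> foldr (\<otimes>\<^bsub>G\<^esub>) w \<one>\<^bsub>G\<^esub> = g)"

lemma word_length_le: "word_reach G S k g \<Longrightarrow> word_length G S g \<le> k"
  unfolding word_length_def word_reach_def by (rule Least_le)

lemma word_reach_length: "word_reach G S k g \<Longrightarrow> word_reach G S (word_length G S g) g"
  unfolding word_length_def word_reach_def by (rule LeastI)

lemma word_reach_zero: "word_reach G S 0 g \<longleftrightarrow> g = \<one>\<^bsub>G\<^esub>"
  by (auto simp: word_reach_def)

lemma (in group) word_reach_closed:
  assumes "S \<subseteq> carrier G" "word_reach G S k g" shows "g \<in> carrier G"
proof -
  have "set w \<subseteq> carrier G \<Longrightarrow> foldr (\<otimes>) w \<one> \<in> carrier G" for w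
    by (induction w) auto
  then show ?thesis using assms by (auto simp: word_reach_def)
qed

lemma (in group) word_reach_mult:
  assumes S: "S \<subseteq> carrier G" and "word_reach G S k g" "word_reach G S l h"
  shows "word_reach G S (k + l) (g \<otimes> h)"
proof -
  obtain v w where v: "length v = k" "set v \<subseteq> S" "foldr (\<otimes>) v \<one> = g"
    and w: "length w = l" "set w \<subseteq> S" "foldr (\<otimes>) w \<one> = h"
    using assms by (auto simp: word_reach_def)
  have h: "h \<in> carrier G" using assms word_reach_closed by blast
  have cl: "set u \<subseteq> S \<Longrightarrow> foldr (\<otimes>) u \<one> \<in> carrier G" for u
    using S by (induction u) auto
  have "set v \<subseteq> S \<Longrightarrow> foldr (\<otimes>) v h = foldr (\<otimes>) v \<one> \<otimes> h"
    using S h cl by (induction v) (auto simp: m_assoc subset_iff)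
  then have "foldr (\<otimes>) (v @ w) \<one> = g \<otimes> h" using v w by simp
  then show ?thesis unfolding word_reach_def using v w
    by (intro exI[of _ "v @ w"]) auto
qed

lemma (in group) word_reach_gen:
  assumes "S \<subseteq> carrier G" "s \<in> S" shows "word_reach G S 1 s"
  unfolding word_reach_def by (rule exI[of _ "[s]"]) (use assms in auto)

lemma (in group) word_reach_inv:
  assumes S: "S \<subseteq> carrier G" "\<And>s. s \<in> S \<Longrightarrow> inv s \<in> S"
  shows "word_reach G S k g \<Longrightarrow> word_reach G S k (inv g)"
proof (induction k arbitrary: g)
  case 0
  then show ?case by (simp add: word_reach_zero)
next
  case (Suc k)
  then obtain s w where w: "length w = k" "set (s # w) \<subseteq> S" "foldr (\<otimes>) (s # w) \<one> = g"
    by (auto simp: word_reach_def length_Suc_conv)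
  define h where "h = foldr (\<otimes>) w \<one>"
  have h: "word_reach G S k h" using w by (auto simp: word_reach_def h_def)
  have g: "g = s \<otimes> h" using w by (simp add: h_def)
  have c: "s \<in> carrier G" "h \<in> carrier G" using w S h word_reach_closed by auto
  have "word_reach G S (k + 1) (inv h \<otimes> inv s)"
    using w S Suc.IH[OF h] by (intro word_reach_mult word_reach_gen) auto
  then show ?case using c g by (simp add: inv_mult_group)
qed

section \<open>Words in \<open>S1\<close>: explicit constructions and the constraints they
  obey\<close>

lemma S1_eq: "S1 = {(1,0,0,1), (1,0,0,-1), (-1,0,0,1), (-1,0,0,-1),
    (0,1,0,0), (0,-1,0,0), (0,0,1,0), (0,0,-1,0)}"
  unfolding S1_def Let_def by auto

abbreviation reach :: "nat \<Rightarrow> real \<times> real \<times> real \<times> real \<Rightarrow> bool" where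
  "reach \<equiv> word_reach RH3 S1"

lemma reach_mult: "reach k g \<Longrightarrow> reach l h \<Longrightarrow> reach (k + l) (g \<otimes>\<^bsub>RH3\<^esub> h)"
  by (rule group.word_reach_mult[OF group_RH3]) auto

lemma reach_gen: "s \<in> S1 \<Longrightarrow> reach 1 s"
  by (rule group.word_reach_gen[OF group_RH3]) auto

lemma reach_inv: "reach k g \<Longrightarrow> reach k (inv\<^bsub>RH3\<^esub> g)"
  by (rule group.word_reach_inv[OF group_RH3]) (auto simp: S1_eq)

lemma reach_power_gen:
  assumes "(v, x, y, z) \<in> S1"
  shows "reach k (real k * v, real k * x, real k * y, real k * z)"
proof (induction k)
  case 0
  then show ?case by (simp add: word_reach_zero)
next
  case (Suc k)
  from reach_mult[OF reach_gen[OF assms] this] show ?case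
    by (simp add: algebra_simps)
qed

lemma reach_power_gen_int:
  fixes k :: int
  assumes "(v, x, y, z) \<in> S1"
  shows "reach (nat \<bar>k\<bar>) (real_of_int k * v, real_of_int k * x, real_of_int k * y, real_of_int k * z)"
proof (cases "k \<ge> 0")
  case True
  then show ?thesis using reach_power_gen[OF assms, of "nat k"] by simp
next
  case False
  then show ?thesis using reach_inv[OF reach_power_gen[OF assms, of "nat (-k)"]] by simp
qed

text \<open>The word X^a Y^b X^-a Y^-b runs around a rectangle of signed area \<open>a * b\<close>,
  and that area is its central coordinate.\<close>

lemma reach_commutator:
  fixes a b :: int
  shows "reach (2 * nat \<bar>a\<bar> + 2 * nat \<bar>b\<bar>) (0, 0, 0, real_of_int (a * b))"
proof -
  have X: "reach (nat \<bar>k\<bar>) (0, real_of_int k, 0, 0)" for k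
    using reach_power_gen_int[of 0 1 0 0 k] by (simp add: S1_eq)
  have Y: "reach (nat \<bar>k\<bar>) (0, 0, real_of_int k, 0)" for k
    using reach_power_gen_int[of 0 0 1 0 k] by (simp add: S1_eq)
  show ?thesis
    using reach_mult[OF reach_mult[OF X[of a] Y[of b]] reach_mult[OF X[of "-a"] Y[of "-b"]]]
    by (simp add: algebra_simps mult_2 mult_2_right)
qed

text \<open>The centre is quadratically distorted. Division by \<open>r\<close> writes the absolute
  value of \<open>k\<close> as \<open>r * q + s\<close> with \<open>q\<close> at most
  \<open>r\<close> and \<open>s\<close> below \<open>r\<close>, so an \<open>r\<close> by
  \<open>q\<close> and an \<open>s\<close> by 1 commutator suffice, and together they fit into
  \<open>8 * r\<close> letters.\<close>

lemma reach_central: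
  fixes k :: int and r :: nat
  assumes "\<bar>k\<bar> \<le> int r ^ 2"
  shows "\<exists>l\<le>8 * r. reach l (0, 0, 0, real_of_int k)"
proof (cases "r = 0")
  case True
  then show ?thesis using assms by (auto simp: word_reach_zero)
next
  case False
  have nonneg: "\<exists>l\<le>8 * r. reach l (0, 0, 0, real j)" if j: "j \<le> r ^ 2" for j
  proof -
    define q s where "q = j div r" and "s = j mod r"
    have "q \<le> r" using div_le_mono[OF j, of r] False by (simp add: q_def power2_eq_square)
    moreover have "s < r" using False by (simp add: s_def)
    moreover have "j = r * q + s" by (simp add: q_def s_def)
    ultimately show ?thesis
      using reach_mult[OF reach_commutator[of "int r" "int q"] reach_commutator[of "int s" 1]]
      by (intro exI[of _ "2 * r + 2 * q + (2 * s + 2)"]) simp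
  qed
  obtain l where l: "l \<le> 8 * r" "reach l (0, 0, 0, real (nat \<bar>k\<bar>))"
    using nonneg[of "nat \<bar>k\<bar>"] assms by (auto simp: nat_le_iff)
  show ?thesis
  proof (cases "k \<ge> 0")
    case True
    then show ?thesis using l by auto
  next
    case False
    then show ?thesis using l(1) reach_inv[OF l(2)] by auto
  qed
qed

text \<open>The quantity \<open>z - x * y / 2\<close> is the exponent \<open>c\<close> in the normal
  form exp (x X) exp (y Y) exp (c Z). A product adds these exponents up to the correction
  \<open>- y * x'\<close>, which is again an integer.\<close>

lemma heisenberg_int_coords:
  assumes "(x, y, z) \<in> heisenberg_int"
  shows "x \<in> \<int> \<and> y \<in> \<int> \<and> z - x * y / 2 \<in> \<int>"
proof -
  have "case g of (x, y, z) \<Rightarrow> x \<in> \<int> \<and> y \<in> \<int> \<and> z - x * y / 2 \<in> \<int>"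
    if "g \<in> generate heisenberg {(1, 0, 0), (0, 1, 0)}" for g :: "real \<times> real \<times> real"
    using that
  proof (induction rule: generate.induct)
    case (eng g h)
    obtain x y z x' y' z' where gh: "g = (x, y, z)" "h = (x', y', z')"
      by (metis prod_cases3)
    have "z + z' + (x * y' - y * x') / 2 - (x + x') * (y + y') / 2
        = (z - x * y / 2) + (z' - x' * y' / 2) - y * x'" by (simp add: field_simps)
    moreover have "(z - x * y / 2) + (z' - x' * y' / 2) - y * x' \<in> \<int>"
      using eng gh by (auto intro!: Ints_add Ints_diff Ints_mult)
    ultimately have "z + z' + (x * y' - y * x') / 2 - (x + x') * (y + y') / 2 \<in> \<int>"
      by metis
    then show ?case using eng gh by (auto intro: Ints_add)
  qed auto
  from this[of "(x, y, z)"] assms show ?thesis by (simp add: heisenberg_int_def)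
qed

text \<open>The word is a power of (1; 0, 0, 1), then powers of X and Y, then a central element. The
  first factor already contributes \<open>v\<close> to the centre and the product of the next two
  contributes \<open>x * y / 2\<close>, so only \<open>z - x * y / 2 - v\<close> is left to the
  commutators.\<close>

lemma GZ_reach:
  fixes r :: nat
  assumes "(v, x, y, z) \<in> GZ" and z: "\<bar>z - x * y / 2 - v\<bar> \<le> real r ^ 2"
  shows "\<exists>l. real l \<le> \<bar>v\<bar> + \<bar>x\<bar> + \<bar>y\<bar> + 8 * real r \<and> reach l (v, x, y, z)"
proof -
  have int: "v \<in> \<int>" "x \<in> \<int>" "y \<in> \<int>" "z - x * y / 2 \<in> \<int>"
    using assms heisenberg_int_coords by (auto simp: GZ_def)
  obtain t a b k where t: "v = real_of_int t" "x = real_of_int a" "y = real_of_int b"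
    and k: "z - x * y / 2 - v = real_of_int k"
    by (meson int Ints_cases Ints_diff)
  have "real_of_int \<bar>k\<bar> \<le> real_of_int (int r ^ 2)" using z k by simp
  then have "\<bar>k\<bar> \<le> int r ^ 2" by linarith
  then obtain l where l: "l \<le> 8 * r" "reach l (0, 0, 0, real_of_int k)"
    using reach_central by blast
  have T: "reach (nat \<bar>t\<bar>) (v, 0, 0, v)"
    using reach_power_gen_int[of 1 0 0 1 t] t by (simp add: S1_eq)
  have X: "reach (nat \<bar>a\<bar>) (0, x, 0, 0)"
    using reach_power_gen_int[of 0 1 0 0 a] t by (simp add: S1_eq)
  have Y: "reach (nat \<bar>b\<bar>) (0, 0, y, 0)"
    using reach_power_gen_int[of 0 0 1 0 b] t by (simp add: S1_eq)
  have "z = v + x * y / 2 + real_of_int k" using k by simp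
  then have "reach (nat \<bar>t\<bar> + (nat \<bar>a\<bar> + nat \<bar>b\<bar>) + l) (v, x, y, z)"
    using reach_mult[OF reach_mult[OF T reach_mult[OF X Y]] l(2)] by (simp add: add.assoc)
  moreover have "real (nat \<bar>t\<bar> + (nat \<bar>a\<bar> + nat \<bar>b\<bar>) + l) \<le> \<bar>v\<bar> + \<bar>x\<bar> + \<bar>y\<bar> + 8 * real r"
    using l t by simp
  ultimately show ?thesis by blast
qed

lemma GZ_reach_ex: "g \<in> GZ \<Longrightarrow> \<exists>l. reach l g"
proof -
  assume g: "g \<in> GZ"
  obtain v x y z where gv: "g = (v, x, y, z)" by (metis prod_cases4)
  obtain r :: nat where r: "1 + \<bar>z - x * y / 2 - v\<bar> \<le> real r" using real_arch_simple by blast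
  have "real r * 1 \<le> real r * real r" using r by (intro mult_left_mono) auto
  then have "\<bar>z - x * y / 2 - v\<bar> \<le> real r ^ 2" using r by (simp add: power2_eq_square)
  then show ?thesis using GZ_reach g gv by blast
qed

lemma heisenberg_int_subgroup: "subgroup heisenberg_int heisenberg"
  unfolding heisenberg_int_def
  by (rule group.generate_is_subgroup[OF group_heisenberg]) simp

lemma GZ_subgroup: "subgroup GZ RH3"
proof -
  have inv: "inv\<^bsub>real_add_group\<^esub> v = - v" for v
    by (rule group.inv_equality[OF group_real_add_group]) (auto simp: real_add_group_def)
  have "subgroup \<int> real_add_group"
  proof (rule group.subgroupI[OF group_real_add_group])
    fix v w :: real assume "v \<in> \<int>" "w \<in> \<int>"
    then show "v \<otimes>\<^bsub>real_add_group\<^esub> w \<in> \<int>" by (simp add: real_add_group_def)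
  qed (auto simp: inv intro: Ints_0)
  then show ?thesis unfolding GZ_def RH3_def
    by (rule DirProd_subgroups[OF group_real_add_group _ group_heisenberg heisenberg_int_subgroup])
qed

lemma central_in_heisenberg_int: "(0, 0, real k) \<in> heisenberg_int"
proof -
  have X: "(1, 0, 0) \<in> heisenberg_int" and Y: "(0, 1, 0) \<in> heisenberg_int"
    unfolding heisenberg_int_def by (auto intro: generate.incl)
  note cl = subgroup.m_closed[OF heisenberg_int_subgroup]
    and inv = subgroup.m_inv_closed[OF heisenberg_int_subgroup]
  have Z: "(0, 0, 1) \<in> heisenberg_int"
    using cl[OF cl[OF X Y] cl[OF inv[OF X] inv[OF Y]]] by simp
  show ?thesis
  proof (induction k)
    case 0
    then show ?case using subgroup.one_closed[OF heisenberg_int_subgroup] by simp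
  next
    case (Suc k)
    then show ?case using cl[OF Suc Z] by (simp add: add.commute)
  qed
qed

text \<open>\<open>V\<close> counts the letters that move the first coordinate and \<open>H\<close>
  the horizontal ones. A letter of the first kind changes \<open>z\<close> by 1. A horizontal letter
  changes it by at most half a current horizontal coordinate, hence by at most \<open>H\<close>,
  which the growth from \<open>H ^ 2\<close> to \<open>(H + 1) ^ 2\<close> absorbs.\<close>

lemma reach_bounds:
  assumes "reach k (v, x, y, z)"
  shows "\<exists>V H. V \<ge> 0 \<and> H \<ge> 0 \<and> V + H = real k \<and> \<bar>v\<bar> \<le> V \<and> \<bar>x\<bar> + \<bar>y\<bar> \<le> H \<and> \<bar>z\<bar> \<le> V + H ^ 2"
  using assms
proof (induction k arbitrary: v x y z)
  case 0
  then show ?case by (auto simp: word_reach_zero)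
next
  case (Suc k)
  then obtain s w where w: "length w = k" "set (s # w) \<subseteq> S1"
     "foldr (\<otimes>\<^bsub>RH3\<^esub>) (s # w) \<one>\<^bsub>RH3\<^esub> = (v, x, y, z)"
    by (auto simp: word_reach_def length_Suc_conv)
  obtain v' x' y' z' where h: "foldr (\<otimes>\<^bsub>RH3\<^esub>) w \<one>\<^bsub>RH3\<^esub> = (v', x', y', z')"
    by (metis prod_cases4)
  then have "reach k (v', x', y', z')" using w by (auto simp: word_reach_def)
  from Suc.IH[OF this] obtain V H where VH: "V \<ge> 0" "H \<ge> 0" "V + H = real k" "\<bar>v'\<bar> \<le> V"
    "\<bar>x'\<bar> + \<bar>y'\<bar> \<le> H" "\<bar>z'\<bar> \<le> V + H ^ 2" by blast
  obtain a b c d where s: "s = (a, b, c, d)" by (metis prod_cases4)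
  have eq: "v = a + v'" "x = b + x'" "y = c + y'" "z = d + z' + (b * y' - c * x') / 2"
    using w h s by auto
  have sq: "(H + 1) ^ 2 = H ^ 2 + 2 * H + 1" by (simp add: power2_eq_square algebra_simps)
  have "s \<in> S1" using w by simp
  then consider "\<bar>a\<bar> = 1" "\<bar>d\<bar> = 1" "b = 0" "c = 0"
    | "a = 0" "d = 0" "\<bar>b\<bar> = 1" "c = 0" | "a = 0" "d = 0" "\<bar>c\<bar> = 1" "b = 0"
    unfolding S1_eq s by auto
  then show ?case
  proof cases
    case 1
    then have "\<bar>v\<bar> \<le> \<bar>v'\<bar> + 1" "x = x'" "y = y'" "\<bar>z\<bar> \<le> \<bar>z'\<bar> + 1"
      using eq abs_triangle_ineq[of a v'] abs_triangle_ineq[of d z'] by auto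
    then have "V + 1 \<ge> 0" "(V + 1) + H = real (Suc k)" "\<bar>v\<bar> \<le> V + 1" "\<bar>x\<bar> + \<bar>y\<bar> \<le> H"
      "\<bar>z\<bar> \<le> (V + 1) + H ^ 2" using VH by linarith+
    then show ?thesis using VH(2) by blast
  next
    case 2
    then have "v = v'" "\<bar>x\<bar> \<le> \<bar>x'\<bar> + 1" "y = y'" and z: "z = z' + b * y' / 2"
      using eq abs_triangle_ineq[of b x'] by auto
    moreover have "\<bar>b * y' / 2\<bar> \<le> \<bar>y'\<bar>" using 2 by (simp add: abs_mult)
    then have "\<bar>z\<bar> \<le> \<bar>z'\<bar> + \<bar>y'\<bar>" unfolding z by linarith
    ultimately have "H + 1 \<ge> 0" "V + (H + 1) = real (Suc k)" "\<bar>v\<bar> \<le> V" "\<bar>x\<bar> + \<bar>y\<bar> \<le> H + 1"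
      "\<bar>z\<bar> \<le> V + (H + 1) ^ 2" unfolding sq using VH by linarith+
    then show ?thesis using VH(1) by blast
  next
    case 3
    then have "v = v'" "x = x'" "\<bar>y\<bar> \<le> \<bar>y'\<bar> + 1" and z: "z = z' - c * x' / 2"
      using eq abs_triangle_ineq[of c y'] by auto
    moreover have "\<bar>c * x' / 2\<bar> \<le> \<bar>x'\<bar>" using 3 by (simp add: abs_mult)
    then have "\<bar>z\<bar> \<le> \<bar>z'\<bar> + \<bar>x'\<bar>" unfolding z by linarith
    ultimately have "H + 1 \<ge> 0" "V + (H + 1) = real (Suc k)" "\<bar>v\<bar> \<le> V" "\<bar>x\<bar> + \<bar>y\<bar> \<le> H + 1"
      "\<bar>z\<bar> \<le> V + (H + 1) ^ 2" unfolding sq using VH by linarith+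
    then show ?thesis using VH(1) by blast
  qed
qed

section \<open>The word metric as a metric on the lattice \<open>GZ\<close>\<close>

lemma rho1_eq: "rho1 g h = real (word_length RH3 S1 (inv\<^bsub>RH3\<^esub> g \<otimes>\<^bsub>RH3\<^esub> h))"
  by (simp add: rho1_def word_metric_def)

lemma rho1_le: "reach k (inv\<^bsub>RH3\<^esub> g \<otimes>\<^bsub>RH3\<^esub> h) \<Longrightarrow> rho1 g h \<le> real k"
  unfolding rho1_eq using word_length_le by auto

text \<open>On \<open>GZ\<close> the \<open>LEAST\<close> in \<open>word_length\<close> is attained,
  so each distance comes with a word that realises it.\<close>

lemma rho1_reach:
  assumes "g \<in> GZ" "h \<in> GZ"
  obtains k where "rho1 g h = real k" "reach k (inv\<^bsub>RH3\<^esub> g \<otimes>\<^bsub>RH3\<^esub> h)"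
proof -
  have "inv\<^bsub>RH3\<^esub> g \<otimes>\<^bsub>RH3\<^esub> h \<in> GZ"
    using assms GZ_subgroup by (simp add: subgroup.m_closed subgroup.m_inv_closed)
  then obtain l where "reach l (inv\<^bsub>RH3\<^esub> g \<otimes>\<^bsub>RH3\<^esub> h)" using GZ_reach_ex by blast
  from word_reach_length[OF this] show ?thesis using that rho1_eq by blast
qed

lemma rho1_metric: "Metric_space GZ rho1"
proof
  fix g h show "0 \<le> rho1 g h" by (simp add: rho1_eq)
next
  fix g h
  show "rho1 g h = rho1 h g"
  proof -
    have "word_length RH3 S1 u = word_length RH3 S1 (inv\<^bsub>RH3\<^esub> u)" for u
    proof -
      have "reach k u \<longleftrightarrow> reach k (inv\<^bsub>RH3\<^esub> u)" for k
        using reach_inv[of k u] reach_inv[of k "inv\<^bsub>RH3\<^esub> u"]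
        by (auto simp: group.inv_inv[OF group_RH3])
      then show ?thesis unfolding word_length_def word_reach_def[symmetric] by simp
    qed
    from this[of "inv\<^bsub>RH3\<^esub> g \<otimes>\<^bsub>RH3\<^esub> h"] show ?thesis unfolding rho1_eq
      by (simp add: group.inv_mult_group group.inv_inv group.inv_closed group_RH3)
  qed
next
  fix g h assume gh: "g \<in> GZ" "h \<in> GZ"
  obtain k where k: "rho1 g h = real k" "reach k (inv\<^bsub>RH3\<^esub> g \<otimes>\<^bsub>RH3\<^esub> h)"
    using rho1_reach gh by blast
  show "rho1 g h = 0 \<longleftrightarrow> g = h"
  proof
    assume "rho1 g h = 0"
    then have "inv\<^bsub>RH3\<^esub> g \<otimes>\<^bsub>RH3\<^esub> h = \<one>\<^bsub>RH3\<^esub>" using k by (simp add: word_reach_zero)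
    then show "g = h"
      by (metis UNIV_I carriers(3) group.inv_closed group.inv_equality group.inv_inv group_RH3)
  next
    assume "g = h"
    then have "reach 0 (inv\<^bsub>RH3\<^esub> g \<otimes>\<^bsub>RH3\<^esub> h)"
      using group.l_inv[OF group_RH3] by (simp add: word_reach_zero)
    from rho1_le[OF this] show "rho1 g h = 0" by (simp add: rho1_eq)
  qed
next
  fix f g h assume fgh: "f \<in> GZ" "g \<in> GZ" "h \<in> GZ"
  obtain k where k: "rho1 f g = real k" "reach k (inv\<^bsub>RH3\<^esub> f \<otimes>\<^bsub>RH3\<^esub> g)"
    using rho1_reach fgh by blast
  obtain l where l: "rho1 g h = real l" "reach l (inv\<^bsub>RH3\<^esub> g \<otimes>\<^bsub>RH3\<^esub> h)"
    using rho1_reach fgh by blast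
  have "(inv\<^bsub>RH3\<^esub> f \<otimes>\<^bsub>RH3\<^esub> g) \<otimes>\<^bsub>RH3\<^esub> (inv\<^bsub>RH3\<^esub> g \<otimes>\<^bsub>RH3\<^esub> h) = inv\<^bsub>RH3\<^esub> f \<otimes>\<^bsub>RH3\<^esub> h"
    by (cases f; cases g; cases h) (simp add: field_simps)
  then show "rho1 f h \<le> rho1 f g + rho1 g h"
    using rho1_le[of "k + l" f h] reach_mult[OF k(2) l(2)] k l by simp
qed

section \<open>The subFinsler metric\<close>

lemmas heis_assoc = monoid.m_assoc[OF group.is_monoid[OF group_heisenberg], simplified]

lemma heis_inv_cancel:
  "g \<otimes>\<^bsub>heisenberg\<^esub> (inv\<^bsub>heisenberg\<^esub> g \<otimes>\<^bsub>heisenberg\<^esub> h) = h"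
  "inv\<^bsub>heisenberg\<^esub> g \<otimes>\<^bsub>heisenberg\<^esub> (g \<otimes>\<^bsub>heisenberg\<^esub> h) = h"
  using monoid.l_one[OF group.is_monoid[OF group_heisenberg], of h]
  by (simp_all add: heis_assoc[symmetric] group.r_inv[OF group_heisenberg]
      group.l_inv[OF group_heisenberg])

section \<open>Operations on horizontal paths, and the range of their endpoints\<close>

lemma horizontal_path_nonneg: "horizontal_path p q L \<Longrightarrow> 0 \<le> L"
  by (induction rule: horizontal_path.induct) auto

lemma horizontal_path_trans:
  assumes "horizontal_path q r M" "horizontal_path p q L"
  shows "horizontal_path p r (L + M)"
  using assms
proof (induction rule: horizontal_path.induct)
  case trivial
  then show ?case by simp
next
  case (segment r M T a b)
  then have "horizontal_path p r (L + M)" by simp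
  from horizontal_path.segment[OF this segment(2), of a b] show ?case by (simp add: add.assoc)
qed

lemma horizontal_path_segment:
  "horizontal_path p (p \<otimes>\<^bsub>heisenberg\<^esub> (a, b, 0)) (\<bar>a\<bar> + \<bar>b\<bar>)"
  using horizontal_path.segment[OF horizontal_path.trivial, of 1 p a b] by simp

lemma horizontal_path_translate:
  "horizontal_path p q L \<Longrightarrow>
    horizontal_path (g \<otimes>\<^bsub>heisenberg\<^esub> p) (g \<otimes>\<^bsub>heisenberg\<^esub> q) L"
  by (induction rule: horizontal_path.induct)
     (auto intro: horizontal_path.intros simp: heis_assoc[symmetric])

lemma horizontal_path_sym: "horizontal_path p q L \<Longrightarrow> horizontal_path q p L"
proof (induction rule: horizontal_path.induct)
  case trivial
  show ?case by (rule horizontal_path.trivial)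
next
  case (segment q L T a b)
  let ?r = "q \<otimes>\<^bsub>heisenberg\<^esub> (T * a, T * b, 0)"
  have "?r \<otimes>\<^bsub>heisenberg\<^esub> (- (T * a), - (T * b), 0) = q"
    by (cases q) (simp add: algebra_simps diff_divide_distrib)
  then have "horizontal_path ?r q (T * (\<bar>a\<bar> + \<bar>b\<bar>))"
    using horizontal_path_segment[of ?r "- (T * a)" "- (T * b)"] segment(2)
    by (simp add: abs_mult distrib_left)
  from horizontal_path_trans[OF segment(3) this] show ?case by (simp add: add.commute)
qed

definition heis_dilation :: "real \<Rightarrow> real \<times> real \<times> real \<Rightarrow> real \<times> real \<times> real" where
  "heis_dilation l = (\<lambda>(x, y, z). (l * x, l * y, l\<^sup>2 * z))"

lemma heis_dilation_mult:
  "heis_dilation l (p \<otimes>\<^bsub>heisenberg\<^esub> q) = heis_dilation l p \<otimes>\<^bsub>heisenberg\<^esub> heis_dilation l q"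
  by (cases p; cases q) (simp add: heis_dilation_def algebra_simps power2_eq_square diff_divide_distrib)

lemma horizontal_path_dilate:
  assumes "0 \<le> l" "horizontal_path p q L"
  shows "horizontal_path (heis_dilation l p) (heis_dilation l q) (l * L)"
  using assms(2)
proof (induction rule: horizontal_path.induct)
  case trivial
  show ?case by (simp add: horizontal_path.trivial)
next
  case (segment q L T a b)
  from horizontal_path.segment[OF segment(3,2), of "l * a" "l * b"] show ?case using assms(1)
    unfolding heis_dilation_mult
    by (simp add: heis_dilation_def abs_mult algebra_simps)
qed

text \<open>A further segment of length \<open>l\<close> changes the central coordinate by at most
  half of \<open>L * l\<close>, because the horizontal part is still bounded by \<open>L\<close>;
  and L^2 / 2 + L l / 2 is at most (L + l)^2 / 2.\<close>

lemma horizontal_path_bounds: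
  assumes "horizontal_path (0, 0, 0) (x, y, z) L"
  shows "\<bar>x\<bar> + \<bar>y\<bar> \<le> L" "\<bar>z\<bar> \<le> L\<^sup>2 / 2"
proof -
  have "case q of (x, y, z) \<Rightarrow> 0 \<le> L \<and> \<bar>x\<bar> + \<bar>y\<bar> \<le> L \<and> \<bar>z\<bar> \<le> L\<^sup>2 / 2"
    if "horizontal_path (0, 0, 0) q L" for q L
    using that
  proof (induction rule: horizontal_path.induct)
    case (segment q L T a b)
    obtain x y z where q: "q = (x, y, z)" by (metis prod_cases3)
    have L: "0 \<le> L" "\<bar>x\<bar> + \<bar>y\<bar> \<le> L" "\<bar>z\<bar> \<le> L\<^sup>2 / 2" using segment q by auto
    define l where "l = T * (\<bar>a\<bar> + \<bar>b\<bar>)"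
    have l: "\<bar>T * a\<bar> + \<bar>T * b\<bar> = l" using segment by (simp add: l_def abs_mult algebra_simps)
    have l0: "0 \<le> l" using l by linarith
    have "\<bar>x * (T * b) - y * (T * a)\<bar> \<le> \<bar>x\<bar> * \<bar>T * b\<bar> + \<bar>y\<bar> * \<bar>T * a\<bar>"
      unfolding abs_mult[symmetric] by (rule abs_triangle_ineq4)
    also have "\<dots> \<le> \<bar>x\<bar> * l + \<bar>y\<bar> * l"
      by (intro add_mono mult_left_mono) (use l in auto)
    also have "\<dots> = (\<bar>x\<bar> + \<bar>y\<bar>) * l" by (simp add: algebra_simps)
    also have "\<dots> \<le> L * l" using L l0 by (intro mult_right_mono)
    finally have A: "\<bar>x * (T * b) - y * (T * a)\<bar> \<le> L * l" .
    have "\<bar>z + (x * (T * b) - y * (T * a)) / 2\<bar> \<le> \<bar>z\<bar> + \<bar>x * (T * b) - y * (T * a)\<bar> / 2"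
      using abs_triangle_ineq[of z "(x * (T * b) - y * (T * a)) / 2"] by simp
    also have "\<dots> \<le> L\<^sup>2 / 2 + L * l / 2" by (intro add_mono divide_right_mono) (use A L in auto)
    also have "\<dots> \<le> (L + l)\<^sup>2 / 2" using L l0 by (simp add: power2_eq_square algebra_simps)
    finally have "\<bar>z + (x * (T * b) - y * (T * a)) / 2\<bar> \<le> (L + l)\<^sup>2 / 2" .
    moreover have "\<bar>x + T * a\<bar> + \<bar>y + T * b\<bar> \<le> L + l"
      using abs_triangle_ineq[of x "T * a"] abs_triangle_ineq[of y "T * b"] L l by linarith
    ultimately show ?case using L l0 unfolding q l_def[symmetric] by simp
  qed simp
  from this[OF assms] show "\<bar>x\<bar> + \<bar>y\<bar> \<le> L" "\<bar>z\<bar> \<le> L\<^sup>2 / 2" by auto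
qed

text \<open>A closed rectangle in the horizontal plane first produces the central coordinate, then
  one segment produces \<open>x\<close> and \<open>y\<close> without changing it.\<close>

lemma horizontal_path_ex:
  "horizontal_path (0, 0, 0) (x, y, z) (\<bar>x\<bar> + \<bar>y\<bar> + 4 * sqrt \<bar>z\<bar>)"
proof -
  define s where "s = sqrt \<bar>z\<bar>"
  \<comment> \<open>The rectangle with sides \<open>s\<close> and \<open>r\<close> is a square up to
    orientation, and the sign of \<open>r\<close> gives it signed area \<open>z\<close>.\<close>
  define r where "r = sgn z * s"
  have rs: "s * r = z" "\<bar>s\<bar> = s" "\<bar>r\<bar> = s"
    by (auto simp: s_def r_def abs_mult abs_sgn_eq mult.commute mult.left_commute sgn_mult_abs)
       (metis mult.commute sgn_mult_abs)
  have "horizontal_path (0, 0, 0) (s, r, s * r / 2) (s + s)"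
    using horizontal_path_trans[OF horizontal_path_segment[of "(s, 0, 0)" 0 r, simplified]
      horizontal_path_segment[of "(0, 0, 0)" s 0, simplified]] rs by simp
  moreover have "horizontal_path (s, r, s * r / 2) (0, 0, s * r) (s + s)"
    using horizontal_path_trans[OF horizontal_path_segment[of "(0, r, s * r)" 0 "- r", simplified],
        of "(s, r, s * r / 2)" s]
      horizontal_path_segment[of "(s, r, s * r / 2)" "- s" 0] rs by (simp add: mult.commute)
  ultimately have "horizontal_path (0, 0, 0) (0, 0, z) (4 * s)"
    using horizontal_path_trans rs(1) by force
  from horizontal_path_trans[OF horizontal_path_segment[of "(0, 0, z)" x y] this]
  show ?thesis by (simp add: s_def add.commute)
qed

text \<open>Points on almost shortest paths replace points on geodesics, since \<open>d3\<close> is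
  an infimum and its attainment is not established.\<close>

lemma horizontal_path_split:
  assumes "horizontal_path p q L" "0 \<le> s" "s \<le> L"
  shows "\<exists>h. horizontal_path p h s \<and> horizontal_path h q (L - s)"
  using assms
proof (induction rule: horizontal_path.induct)
  case trivial
  then show ?case by (intro exI[of _ p]) (simp add: horizontal_path.trivial)
next
  case (segment q L T a b)
  let ?r = "q \<otimes>\<^bsub>heisenberg\<^esub> (T * a, T * b, 0)"
  show ?case
  proof (cases "s \<le> L")
    case True
    then obtain h where h: "horizontal_path p h s" "horizontal_path h q (L - s)"
      using segment by blast
    from horizontal_path.segment[OF h(2) segment(2), of a b] h(1) show ?thesis
      by (intro exI[of _ h]) (simp add: algebra_simps)
  next
    case False
    \<comment> \<open>The cut falls inside the last segment. Its speed \<open>c\<close> is nonzero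
      because the segment has positive length, and \<open>u\<close> is the time at which the total
      length reaches \<open>s\<close>.\<close>
    define c where "c = \<bar>a\<bar> + \<bar>b\<bar>"
    have "c \<noteq> 0" using False segment(5) by (auto simp: c_def[symmetric])
    then have c: "c > 0" by (simp add: c_def)
    define u where "u = (s - L) / c"
    have u: "0 \<le> u" "u \<le> T" "u * c = s - L"
      using False segment c by (auto simp: u_def c_def[symmetric] field_simps)
    let ?h = "q \<otimes>\<^bsub>heisenberg\<^esub> (u * a, u * b, 0)"
    have "horizontal_path p ?h s"
      using horizontal_path.segment[OF segment(1) u(1), of a b] u(3) by (simp add: c_def)
    moreover have "?h \<otimes>\<^bsub>heisenberg\<^esub> ((T - u) * a, (T - u) * b, 0) = ?r"
      by (cases q) (simp add: algebra_simps diff_divide_distrib add_divide_distrib)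
    then have "horizontal_path ?h ?r ((T - u) * c)"
      using horizontal_path.segment[OF horizontal_path.trivial, of "T - u" ?h a b] u(2)
      by (simp add: c_def)
    moreover have "(T - u) * c = L + T * c - s" using u(3) by (simp add: algebra_simps)
    ultimately show ?thesis by (intro exI[of _ ?h]) (simp add: c_def)
  qed
qed

lemma horizontal_path_translate_iff:
  "horizontal_path (g \<otimes>\<^bsub>heisenberg\<^esub> p) (g \<otimes>\<^bsub>heisenberg\<^esub> q) L \<longleftrightarrow> horizontal_path p q L"
  using horizontal_path_translate[of p q L g]
    horizontal_path_translate[of "g \<otimes>\<^bsub>heisenberg\<^esub> p" "g \<otimes>\<^bsub>heisenberg\<^esub> q" L "inv\<^bsub>heisenberg\<^esub> g"]
  unfolding heis_inv_cancel by blast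

section \<open>The left-invariant metric \<open>d3\<close> and its comparison with
  coordinates\<close>

lemma d3_translate: "d3 (g \<otimes>\<^bsub>heisenberg\<^esub> p) (g \<otimes>\<^bsub>heisenberg\<^esub> q) = d3 p q"
  by (simp add: d3_def horizontal_path_translate_iff)

lemma d3_eq_norm: "d3 p q = d3 (0, 0, 0) (inv\<^bsub>heisenberg\<^esub> p \<otimes>\<^bsub>heisenberg\<^esub> q)"
proof -
  have "inv\<^bsub>heisenberg\<^esub> p \<otimes>\<^bsub>heisenberg\<^esub> p = (0, 0, 0)" by (cases p) simp
  then show ?thesis using d3_translate[of "inv\<^bsub>heisenberg\<^esub> p" p q] by simp
qed

text \<open>Connectivity makes the set under the infimum in \<open>d3\<close> nonempty, so that
  lower bounds on path lengths pass to \<open>d3\<close>.\<close>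

lemma horizontal_path_total: "\<exists>L. horizontal_path p q L"
proof -
  obtain L where "horizontal_path (0, 0, 0) (inv\<^bsub>heisenberg\<^esub> p \<otimes>\<^bsub>heisenberg\<^esub> q) L"
    using horizontal_path_ex by (metis prod_cases3)
  from horizontal_path_translate[OF this, of p]
  have "horizontal_path (p \<otimes>\<^bsub>heisenberg\<^esub> (0, 0, 0)) q L" unfolding heis_inv_cancel .
  moreover have "p \<otimes>\<^bsub>heisenberg\<^esub> (0, 0, 0) = p" by (cases p) simp
  ultimately show ?thesis by auto
qed

lemma d3_le: "horizontal_path p q L \<Longrightarrow> d3 p q \<le> L"
  unfolding d3_def
  by (rule cInf_lower) (auto intro!: bdd_belowI[of _ 0] simp: horizontal_path_nonneg)

lemma d3_greatest: "(\<And>L. horizontal_path p q L \<Longrightarrow> c \<le> L) \<Longrightarrow> c \<le> d3 p q"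
  unfolding d3_def using horizontal_path_total by (intro cInf_greatest) auto

lemma d3_approx:
  assumes "0 < e"
  obtains L where "horizontal_path p q L" "L < d3 p q + e"
  using d3_greatest[of p q "d3 p q + e"] assms by force

lemma d3_nonneg: "0 \<le> d3 p q"
  by (rule d3_greatest) (rule horizontal_path_nonneg)

lemma d3_sym: "d3 p q = d3 q p"
proof -
  have "horizontal_path p q = horizontal_path q p" by (intro ext iffI) (erule horizontal_path_sym)+
  then show ?thesis by (simp add: d3_def)
qed

lemma d3_triangle: "d3 p r \<le> d3 p q + d3 q r"
proof -
  have "d3 p r - M \<le> d3 p q" if M: "horizontal_path q r M" for M
  proof (rule d3_greatest)
    fix L assume "horizontal_path p q L"
    from d3_le[OF horizontal_path_trans[OF M this]] show "d3 p r - M \<le> L" by simp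
  qed
  then have "d3 p r - d3 p q \<le> d3 q r" by (intro d3_greatest) force
  then show ?thesis by simp
qed

lemma d3_norm_upper: "d3 (0, 0, 0) (x, y, z) \<le> \<bar>x\<bar> + \<bar>y\<bar> + 4 * sqrt \<bar>z\<bar>"
  by (rule d3_le[OF horizontal_path_ex])

lemma d3_norm_lower:
  "\<bar>x\<bar> + \<bar>y\<bar> \<le> d3 (0, 0, 0) (x, y, z)" "sqrt (2 * \<bar>z\<bar>) \<le> d3 (0, 0, 0) (x, y, z)"
proof -
  show "\<bar>x\<bar> + \<bar>y\<bar> \<le> d3 (0, 0, 0) (x, y, z)"
    by (rule d3_greatest) (rule horizontal_path_bounds)
  show "sqrt (2 * \<bar>z\<bar>) \<le> d3 (0, 0, 0) (x, y, z)"
  proof (rule d3_greatest)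
    fix L assume L: "horizontal_path (0, 0, 0) (x, y, z) L"
    then have "2 * \<bar>z\<bar> \<le> L\<^sup>2" using horizontal_path_bounds(2)[OF L] by simp
    then show "sqrt (2 * \<bar>z\<bar>) \<le> L" using horizontal_path_nonneg[OF L] real_le_lsqrt by simp
  qed
qed

lemma d3_eq_0_iff: "d3 p q = 0 \<longleftrightarrow> p = q"
proof
  assume "p = q"
  then show "d3 p q = 0" using d3_le[OF horizontal_path.trivial[of p]] d3_nonneg[of p p] by simp
next
  assume "d3 p q = 0"
  obtain x y z where g: "inv\<^bsub>heisenberg\<^esub> p \<otimes>\<^bsub>heisenberg\<^esub> q = (x, y, z)" by (metis prod_cases3)
  then have "d3 (0, 0, 0) (x, y, z) = 0" using d3_eq_norm[of p q] \<open>d3 p q = 0\<close> by simp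
  then have "\<bar>x\<bar> + \<bar>y\<bar> \<le> 0" "sqrt (2 * \<bar>z\<bar>) \<le> 0" using d3_norm_lower[where x = x and y = y and z = z] by auto
  then have "x = 0" "y = 0" "z = 0" by auto
  then show "p = q" using g by (cases p; cases q) auto
qed

lemma d3_dilate:
  assumes "0 < l"
  shows "d3 (heis_dilation l p) (heis_dilation l q) \<le> l * d3 p q"
proof -
  have "d3 (heis_dilation l p) (heis_dilation l q) / l \<le> d3 p q"
  proof (rule d3_greatest)
    fix L assume "horizontal_path p q L"
    from d3_le[OF horizontal_path_dilate[OF _ this, of l]] assms
    show "d3 (heis_dilation l p) (heis_dilation l q) / l \<le> L"
      by (simp add: pos_divide_le_eq mult.commute)
  qed
  then show ?thesis using assms by (simp add: pos_divide_le_eq mult.commute)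
qed

section \<open>The cost of moving the central coordinate\<close>

lemma d3_mult_segment:
  "d3 p (q \<otimes>\<^bsub>heisenberg\<^esub> (a, b, 0)) \<le> d3 p q + (\<bar>a\<bar> + \<bar>b\<bar>)"
  using d3_triangle[of p "q \<otimes>\<^bsub>heisenberg\<^esub> (a, b, 0)" q] d3_le[OF horizontal_path_segment[of q a b]]
  by linarith

text \<open>Conjugation by exp (a X + b Y) fixes \<open>x\<close> and \<open>y\<close> and shifts
  \<open>z\<close> by \<open>a * y - b * x\<close>. Its price is one horizontal segment on each
  side.\<close>

lemma d3_conj_segment:
  "d3 (0, 0, 0) (x, y, z + (a * y - b * x)) \<le> d3 (0, 0, 0) (x, y, z) + 2 * (\<bar>a\<bar> + \<bar>b\<bar>)"
proof -
  have "d3 (0, 0, 0) ((a, b, 0) \<otimes>\<^bsub>heisenberg\<^esub> (x, y, z))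
    \<le> d3 (0, 0, 0) (a, b, 0) + d3 (a, b, 0) ((a, b, 0) \<otimes>\<^bsub>heisenberg\<^esub> (x, y, z))"
    by (rule d3_triangle)
  also have "d3 (a, b, 0) ((a, b, 0) \<otimes>\<^bsub>heisenberg\<^esub> (x, y, z)) = d3 (0, 0, 0) (x, y, z)"
    using d3_translate[of "(a, b, 0)" "(0, 0, 0)" "(x, y, z)"] by simp
  also have "d3 (0, 0, 0) (a, b, 0) \<le> \<bar>a\<bar> + \<bar>b\<bar>" using d3_norm_upper[of a b 0] by simp
  finally have *: "d3 (0, 0, 0) ((a, b, 0) \<otimes>\<^bsub>heisenberg\<^esub> (x, y, z))
     \<le> \<bar>a\<bar> + \<bar>b\<bar> + d3 (0, 0, 0) (x, y, z)" by simp
  have eq: "(a, b, 0) \<otimes>\<^bsub>heisenberg\<^esub> (x, y, z) \<otimes>\<^bsub>heisenberg\<^esub> (- a, - b, 0)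
      = (x, y, z + (a * y - b * x))" by (simp add: field_simps)
  show ?thesis
    using d3_mult_segment[of "(0, 0, 0)" "(a, b, 0) \<otimes>\<^bsub>heisenberg\<^esub> (x, y, z)" "- a" "- b"] *
    unfolding eq by simp
qed

text \<open>
  Far from the identity a central perturbation costs only a linear amount: either the
  horizontal part is large and conjugation moves the centre, or the central part is large and
  a dilation does.
\<close>

lemma d3_central_perturb:
  assumes big: "1 / 2 \<le> d3 (0, 0, 0) (x, y, z)" and small: "d3 (0, 0, 0) (x, y, z) \<le> 1"
    and u: "\<bar>u\<bar> \<le> 1 / 128"
  shows "d3 (0, 0, 0) (x, y, z + u) \<le> d3 (0, 0, 0) (x, y, z) + 256 * \<bar>u\<bar>"
proof -
  consider "\<bar>x\<bar> \<ge> 1 / 16" | "\<bar>y\<bar> \<ge> 1 / 16" | "\<bar>x\<bar> < 1 / 16" "\<bar>y\<bar> < 1 / 16" by linarith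
  then show ?thesis
  proof cases
    case 1
    \<comment> \<open>Conjugation by exp (- (u / x) Y) shifts \<open>z\<close> by exactly
      \<open>u\<close>.\<close>
    have "\<bar>u / x\<bar> \<le> 16 * \<bar>u\<bar>"
    proof -
      have "\<bar>u\<bar> * 1 \<le> \<bar>u\<bar> * (16 * \<bar>x\<bar>)" using 1 by (intro mult_left_mono) auto
      then show ?thesis using 1 by (auto simp: abs_divide divide_le_eq mult_ac)
    qed
    moreover have "x \<noteq> 0" using 1 by auto
    ultimately show ?thesis using d3_conj_segment[of x y z 0 "- u / x"] by auto
  next
    case 2
    have "\<bar>u / y\<bar> \<le> 16 * \<bar>u\<bar>"
    proof -
      have "\<bar>u\<bar> * 1 \<le> \<bar>u\<bar> * (16 * \<bar>y\<bar>)" using 2 by (intro mult_left_mono) auto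
      then show ?thesis using 2 by (auto simp: abs_divide divide_le_eq mult_ac)
    qed
    moreover have "y \<noteq> 0" using 2 by auto
    ultimately show ?thesis using d3_conj_segment[of x y z "u / y" 0] by auto
  next
    case 3
    \<comment> \<open>With both horizontal coordinates below 1/16, a norm of at least 1/2 forces 4
      sqrt |z| to be at least 3/8.\<close>
    have "3 / 32 \<le> sqrt \<bar>z\<bar>" using d3_norm_upper[of x y z] big 3 by linarith
    then have "(3 / 32)\<^sup>2 \<le> \<bar>z\<bar>" by (metis abs_ge_zero power_mono real_sqrt_pow2 zero_le_divide_iff zero_le_numeral)
    then have z: "9 / 1024 \<le> \<bar>z\<bar>" by (simp add: power2_eq_square)
    define v where "v = u / z"
    have v: "\<bar>v\<bar> < 1" "\<bar>v\<bar> \<le> 114 * \<bar>u\<bar>" "v * z = u"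
    proof -
      show "\<bar>v\<bar> < 1" using z u by (auto simp: v_def abs_divide)
      have "\<bar>u\<bar> * 1 \<le> \<bar>u\<bar> * (114 * \<bar>z\<bar>)" using z by (intro mult_left_mono) auto
      then show "\<bar>v\<bar> \<le> 114 * \<bar>u\<bar>" using z by (auto simp: v_def abs_divide divide_le_eq mult_ac)
      show "v * z = u" using z by (auto simp: v_def)
    qed
    \<comment> \<open>The dilation by \<open>l\<close> carries \<open>z\<close> to
      \<open>z + u\<close>. It also rescales the horizontal part, which a segment parallel to that
      part undoes without affecting the centre. Both operations cost at most |l - 1|, hence at most
      114 |u| each.\<close>
    define l where "l = sqrt (1 + v)"
    have l0: "0 < l" and l2: "l\<^sup>2 = 1 + v" using v by (auto simp: l_def)
    have l: "\<bar>l - 1\<bar> \<le> \<bar>v\<bar>"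
    proof -
      have "v = (l - 1) * (l + 1)" using l2 by (simp add: power2_eq_square algebra_simps)
      then have "\<bar>v\<bar> = \<bar>l - 1\<bar> * (l + 1)" using l0 by (simp add: abs_mult)
      moreover have "\<bar>l - 1\<bar> * 1 \<le> \<bar>l - 1\<bar> * (l + 1)" using l0 by (intro mult_left_mono) auto
      ultimately show ?thesis by simp
    qed
    let ?N = "d3 (0, 0, 0) (x, y, z)"
    have eq: "heis_dilation l (x, y, z) \<otimes>\<^bsub>heisenberg\<^esub> ((1 - l) * x, (1 - l) * y, 0) = (x, y, z + u)"
      using v(3) l2 by (simp add: heis_dilation_def algebra_simps)
    have "d3 (0, 0, 0) (x, y, z + u) \<le> d3 (0, 0, 0) (heis_dilation l (x, y, z))
        + (\<bar>(1 - l) * x\<bar> + \<bar>(1 - l) * y\<bar>)"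
      using d3_mult_segment[of "(0, 0, 0)" "heis_dilation l (x, y, z)" "(1 - l) * x" "(1 - l) * y"]
      unfolding eq .
    moreover have "d3 (0, 0, 0) (heis_dilation l (x, y, z)) \<le> ?N + \<bar>l - 1\<bar>"
    proof -
      have "d3 (0, 0, 0) (heis_dilation l (x, y, z)) \<le> l * ?N"
        using d3_dilate[OF l0, of "(0, 0, 0)" "(x, y, z)"] by (simp add: heis_dilation_def)
      also have "l * ?N = ?N + (l - 1) * ?N" by (simp add: algebra_simps)
      also have "(l - 1) * ?N \<le> \<bar>l - 1\<bar> * 1"
        using small d3_nonneg[of "(0, 0, 0)" "(x, y, z)"] by (intro mult_mono) auto
      finally show ?thesis by simp
    qed
    moreover have "\<bar>(1 - l) * x\<bar> + \<bar>(1 - l) * y\<bar> \<le> \<bar>l - 1\<bar>"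
    proof -
      have "\<bar>l - 1\<bar> * (\<bar>x\<bar> + \<bar>y\<bar>) \<le> \<bar>l - 1\<bar> * 1" using 3 by (intro mult_left_mono) auto
      then show ?thesis by (simp only: abs_mult distrib_left abs_minus_commute mult_1_right)
    qed
    ultimately have "d3 (0, 0, 0) (x, y, z + u) \<le> ?N + 2 * \<bar>l - 1\<bar>" by argo
    then show ?thesis using l v(2) abs_ge_zero[of u] by argo
  qed
qed

section \<open>The product metric on the limit group\<close>

lemma d_inf_eq: "d_inf (t, g) (t', g') = \<bar>t' - t\<bar> + d3 g g'"
  using d3_eq_norm[of g g'] by (cases g; cases g') (simp add: d_inf_def)

lemma d_inf_metric: "Metric_space UNIV d_inf"
proof
  fix p q r :: "real \<times> real \<times> real \<times> real"
  obtain t g t' g' t'' g'' where [simp]: "p = (t, g)" "q = (t', g')" "r = (t'', g'')"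
    by (metis surj_pair)
  show "0 \<le> d_inf p q" by (simp add: d_inf_eq d3_nonneg)
  show "d_inf p q = d_inf q p" by (simp add: d_inf_eq d3_sym[of g] abs_minus_commute)
  show "d_inf p q = 0 \<longleftrightarrow> p = q"
    using d3_nonneg[of g g'] d3_eq_0_iff[of g g'] by (auto simp: d_inf_eq add_nonneg_eq_0_iff)
  show "d_inf p r \<le> d_inf p q + d_inf q r"
    using d3_triangle[of g g'' g'] by (simp add: d_inf_eq)
qed

lemma d_inf_ball_iff: "(t, g) \<in> d_inf_ball r \<longleftrightarrow> \<bar>t\<bar> + d3 (0, 0, 0) g \<le> r"
  by (cases g) (simp add: d_inf_ball_def d_inf_eq)

section \<open>Midpoints in the limit space\<close>

text \<open>The candidate combines a first coordinate taken from one endpoint with a Heisenberg part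
  taken from the other. Towards \<open>(s, g)\<close> the amount \<open>b\<close> saved in the first
  factor pays for the detour in the second; towards \<open>(s', g')\<close> the roles are
  exchanged.\<close>

lemma d_inf_mixed_midpoint:
  assumes p: "(s, g) \<in> d_inf_ball 1" and q: "(s', g') \<in> d_inf_ball 1"
    and e: "0 < e" and b: "0 \<le> b" "2 * b \<le> 1" "b \<le> \<bar>s\<bar>" "b \<le> d3 (0, 0, 0) g'"
  obtains m where "m \<in> d_inf_ball 1" "d_inf (s, g) m \<le> 1 + e" "d_inf m (s', g') \<le> 1 + e"
    "b \<le> d_inf (0, 0, 0, 0) m"
proof -
  obtain L where L: "horizontal_path (0, 0, 0) g' L" "L < d3 (0, 0, 0) g' + e"
    using d3_approx[OF e] by blast
  have "b \<le> L" using d3_le[OF L(1)] b by simp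
  then obtain h where h: "d3 (0, 0, 0) h \<le> b" "d3 h g' \<le> L - b"
    using horizontal_path_split[OF L(1) b(1)] d3_le by blast
  \<comment> \<open>\<open>r\<close> is the point at distance \<open>b\<close> from 0 on the same
    side as \<open>s\<close>, so passing from \<open>s\<close> to \<open>r\<close> saves exactly
    \<open>b\<close> compared with passing to 0.\<close>
  define r where "r = sgn s * b"
  have r: "\<bar>r\<bar> = b" "\<bar>r - s\<bar> = \<bar>s\<bar> - b" using b by (auto simp: r_def abs_mult sgn_if abs_if)
  have "d3 g h \<le> d3 (0, 0, 0) g + b"
    using d3_triangle[of g h "(0, 0, 0)"] h(1) d3_sym[of g] by simp
  then have "d_inf (s, g) (r, h) \<le> 1 + e" using p r e by (simp add: d_inf_eq d_inf_ball_iff)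
  moreover have "d_inf (r, h) (s', g') \<le> 1 + e"
    using q r(1) h(2) L(2) abs_triangle_ineq4[of s' r] by (simp add: d_inf_eq d_inf_ball_iff)
  moreover have "(r, h) \<in> d_inf_ball 1" using r h b by (simp add: d_inf_ball_iff)
  moreover have "b \<le> d_inf (0, 0, 0, 0) (r, h)" using r d3_nonneg by (simp add: d_inf_eq)
  ultimately show ?thesis using that by blast
qed

text \<open>The candidate is exp ((e / 256) Z). By \<open>d3_central_perturb\<close> it is at most
  \<open>e\<close> farther from each endpoint than the identity is, while its own norm is at least
  sqrt (2 e / 256).\<close>

lemma d_inf_central_midpoint:
  assumes p: "(s, g) \<in> d_inf_ball 1" and q: "(s', g') \<in> d_inf_ball 1"
    and big: "1 / 2 \<le> d3 (0, 0, 0) g" "1 / 2 \<le> d3 (0, 0, 0) g'"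
    and e: "0 < e" "e \<le> 1"
  obtains m where "m \<in> d_inf_ball 1" "d_inf (s, g) m \<le> 1 + e" "d_inf m (s', g') \<le> 1 + e"
    "sqrt (e / 128) \<le> d_inf (0, 0, 0, 0) m"
proof -
  define h where "h = (0 :: real, 0 :: real, e / 256)"
  have shift: "d3 f h \<le> d3 (0, 0, 0) f + e" if "1 / 2 \<le> d3 (0, 0, 0) f" "d3 (0, 0, 0) f \<le> 1" for f
  proof -
    obtain x y z where f: "f = (x, y, z)" by (metis prod_cases3)
    have "d3 f h = d3 (0, 0, 0) (x, y, z + - (e / 256))"
      using d3_sym[of f h] d3_eq_norm[of h f] by (simp add: h_def f)
    also have "\<dots> \<le> d3 (0, 0, 0) (x, y, z) + 256 * \<bar>- (e / 256)\<bar>"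
      by (rule d3_central_perturb) (use that e f in auto)
    finally show ?thesis using e f by simp
  qed
  have gs: "\<bar>s\<bar> + d3 (0, 0, 0) g \<le> 1" "\<bar>s'\<bar> + d3 (0, 0, 0) g' \<le> 1"
    using p q by (auto simp: d_inf_ball_iff)
  have "d3 (0, 0, 0) g \<le> 1" "d3 (0, 0, 0) g' \<le> 1" using gs by auto
  then have "d_inf (s, g) (0, h) \<le> 1 + e" "d_inf (0, h) (s', g') \<le> 1 + e"
    using shift[of g] shift[of g'] gs big d3_sym[of h g'] by (auto simp: d_inf_eq)
  moreover have "sqrt (e / 256) \<le> 1 / 4" using e by (intro real_le_lsqrt) (auto simp: power2_eq_square)
  then have "(0, h) \<in> d_inf_ball 1"
    using d3_norm_upper[of 0 0 "e / 256"] e by (simp add: d_inf_ball_iff h_def)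
  moreover have "sqrt (e / 128) \<le> d_inf (0, 0, 0, 0) (0, h)"
    using d3_norm_lower(2)[where x = 0 and y = 0 and z = "e / 256"] e by (simp add: d_inf_eq h_def)
  ultimately show ?thesis using that by blast
qed

text \<open>The two constructions above exclude every configuration in which a Heisenberg part is as
  large as \<open>b\<close>: each of them would yield an approximate midpoint at distance at least
  \<open>b\<close> from the identity.\<close>

lemma d_inf_unique_midpoint:
  assumes p: "(s, g) \<in> d_inf_ball 1" and q: "(s', g') \<in> d_inf_ball 1"
    and far: "2 - 2 * e \<le> d_inf (s, g) (s', g')"
    and mid: "\<And>m. m \<in> d_inf_ball 1 \<Longrightarrow> d_inf (s, g) m \<le> 1 + e \<Longrightarrow> d_inf m (s', g') \<le> 1 + e
      \<Longrightarrow> d_inf (0, 0, 0, 0) m < b"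
    and e: "0 < e" "e \<le> 1" "b + 2 * e \<le> 1 / 2" "0 \<le> b" "b \<le> sqrt (e / 128)"
  shows "d3 (0, 0, 0) g < b \<and> d3 (0, 0, 0) g' < b"
proof -
  let ?a = "d3 (0, 0, 0) g" and ?a' = "d3 (0, 0, 0) g'"
  have in1: "\<bar>s\<bar> + ?a \<le> 1" "\<bar>s'\<bar> + ?a' \<le> 1" using p q by (auto simp: d_inf_ball_iff)
  have "d_inf (s, g) (s', g') \<le> (\<bar>s\<bar> + ?a) + (\<bar>s'\<bar> + ?a')"
    using d3_triangle[of g g' "(0, 0, 0)"] d3_sym[of g "(0, 0, 0)"] by (simp add: d_inf_eq)
  \<comment> \<open>Two points of the unit ball at distance almost 2 both lie close to the unit
    sphere.\<close>
  then have out: "1 - 2 * e \<le> \<bar>s\<bar> + ?a" "1 - 2 * e \<le> \<bar>s'\<bar> + ?a'" using in1 far by linarith+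
  have b1: "\<bar>s\<bar> < b \<or> ?a' < b"
  proof (rule ccontr)
    assume "\<not> ?thesis"
    then have *: "b \<le> \<bar>s\<bar>" "b \<le> ?a'" "2 * b \<le> 1" using e by linarith+
    obtain m where "m \<in> d_inf_ball 1" "d_inf (s, g) m \<le> 1 + e" "d_inf m (s', g') \<le> 1 + e"
      "b \<le> d_inf (0, 0, 0, 0) m"
      by (rule d_inf_mixed_midpoint[OF p q e(1) e(4) *(3,1,2)])
    then show False using mid[of m] by simp
  qed
  have sym: "d_inf u v = d_inf v u" for u v by (rule Metric_space.commute[OF d_inf_metric])
  have b2: "\<bar>s'\<bar> < b \<or> ?a < b"
  proof (rule ccontr)
    assume "\<not> ?thesis"
    then have *: "b \<le> \<bar>s'\<bar>" "b \<le> ?a" "2 * b \<le> 1" using e by linarith+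
    obtain m where "m \<in> d_inf_ball 1" "d_inf (s', g') m \<le> 1 + e" "d_inf m (s, g) \<le> 1 + e"
      "b \<le> d_inf (0, 0, 0, 0) m"
      by (rule d_inf_mixed_midpoint[OF q p e(1) e(4) *(3,1,2)])
    then show False using mid[of m] by (simp add: sym)
  qed
  have b3: "?a < 1 / 2 \<or> ?a' < 1 / 2"
  proof (rule ccontr)
    assume "\<not> ?thesis"
    then have *: "1 / 2 \<le> ?a" "1 / 2 \<le> ?a'" by linarith+
    obtain m where "m \<in> d_inf_ball 1" "d_inf (s, g) m \<le> 1 + e" "d_inf m (s', g') \<le> 1 + e"
      "sqrt (e / 128) \<le> d_inf (0, 0, 0, 0) m"
      by (rule d_inf_central_midpoint[OF p q * e(1,2)])
    then show False using mid[of m] e by simp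
  qed
  \<comment> \<open>If \<open>?a\<close> were at least \<open>b\<close>, then \<open>b2\<close>
    would make |s'| small, so \<open>?a'\<close> would exceed 1/2 by \<open>out\<close>; then
    \<open>b1\<close> makes |s| small and \<open>?a\<close> exceeds 1/2 as well, against
    \<open>b3\<close>. The other case is symmetric.\<close>
  from b1 b2 b3 out e show ?thesis by linarith
qed

section \<open>Lower bounds for the Gromov--Hausdorff distance\<close>

text \<open>The bounds on \<open>d\<close> guarantee that the real-valued \<open>SUP\<close> and
  \<open>INF\<close> are genuine suprema and infima.\<close>

lemma hausdorff_distance_less:
  assumes less: "hausdorff_distance d A B < e" and ne: "A \<noteq> {}" "B \<noteq> {}"
    and bd: "\<And>a b. a \<in> A \<Longrightarrow> b \<in> B \<Longrightarrow> 0 \<le> d a b \<and> d a b \<le> M"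
  shows "a \<in> A \<Longrightarrow> \<exists>b\<in>B. d a b < e" "b \<in> B \<Longrightarrow> \<exists>a\<in>A. d a b < e"
proof -
  have sup: "(SUP a\<in>A. INF b\<in>B. d a b) < e" "(SUP b\<in>B. INF a\<in>A. d a b) < e"
    using less by (auto simp: hausdorff_distance_def)
  have below: "bdd_below (d a ` B)" if "a \<in> A" for a
    by (rule bdd_belowI[of _ 0]) (use bd that in auto)
  have below': "bdd_below ((\<lambda>a. d a b) ` A)" if "b \<in> B" for b
    by (rule bdd_belowI[of _ 0]) (use bd that in auto)
  obtain a0 b0 where ab: "a0 \<in> A" "b0 \<in> B" using ne by blast
  have above: "(INF b\<in>B. d a b) \<le> M" if "a \<in> A" for a
    using cINF_lower[OF below[OF that] ab(2)] bd[OF that ab(2)] by linarith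
  have above': "(INF a\<in>A. d a b) \<le> M" if "b \<in> B" for b
    using cINF_lower[OF below'[OF that] ab(1)] bd[OF ab(1) that] by linarith
  {
    assume a: "a \<in> A"
    have "(INF b\<in>B. d a b) \<le> (SUP a\<in>A. INF b\<in>B. d a b)"
      by (rule cSUP_upper[OF a]) (use above in \<open>auto intro!: bdd_aboveI\<close>)
    then have "(INF b\<in>B. d a b) < e" using sup by simp
    then show "\<exists>b\<in>B. d a b < e" using cINF_less_iff[OF ne(2) below[OF a]] by blast
  }
  {
    assume b: "b \<in> B"
    have "(INF a\<in>A. d a b) \<le> (SUP b\<in>B. INF a\<in>A. d a b)"
      by (rule cSUP_upper[OF b]) (use above' in \<open>auto intro!: bdd_aboveI\<close>)
    then have "(INF a\<in>A. d a b) < e" using sup by simp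
    then show "\<exists>a\<in>A. d a b < e" using cINF_less_iff[OF ne(1) below'[OF b]] by blast
  }
qed

text \<open>A constant cross distance of at least half of both diameters respects the triangle
  inequality. This supplies one admissible metric on the disjoint union, so the infimum in
  \<open>gh_distance\<close> is over a nonempty set.\<close>

lemma Metric_space_Plus:
  assumes A: "Metric_space A dA" and B: "Metric_space B dB" and r: "0 < r"
    and bA: "\<And>x y. x \<in> A \<Longrightarrow> y \<in> A \<Longrightarrow> dA x y \<le> 2 * r"
    and bB: "\<And>x y. x \<in> B \<Longrightarrow> y \<in> B \<Longrightarrow> dB x y \<le> 2 * r"
  shows "Metric_space (A <+> B) (\<lambda>u v. case u of
      Inl a \<Rightarrow> (case v of Inl a' \<Rightarrow> dA a a' | Inr b \<Rightarrow> r)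
    | Inr b \<Rightarrow> (case v of Inl a \<Rightarrow> r | Inr b' \<Rightarrow> dB b b'))"
proof
  note nn = Metric_space.nonneg[OF A] Metric_space.nonneg[OF B]
  note tri = Metric_space.triangle[OF A] Metric_space.triangle[OF B]
  fix u v w :: "'a + 'b"
  show "0 \<le> (case u of Inl a \<Rightarrow> (case v of Inl a' \<Rightarrow> dA a a' | Inr b \<Rightarrow> r)
    | Inr b \<Rightarrow> (case v of Inl a \<Rightarrow> r | Inr b' \<Rightarrow> dB b b'))"
    using nn r by (auto split: sum.split)
  show "(case u of Inl a \<Rightarrow> (case v of Inl a' \<Rightarrow> dA a a' | Inr b \<Rightarrow> r)
      | Inr b \<Rightarrow> (case v of Inl a \<Rightarrow> r | Inr b' \<Rightarrow> dB b b'))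
    = (case v of Inl a \<Rightarrow> (case u of Inl a' \<Rightarrow> dA a a' | Inr b \<Rightarrow> r)
      | Inr b \<Rightarrow> (case u of Inl a \<Rightarrow> r | Inr b' \<Rightarrow> dB b b'))"
    using Metric_space.commute[OF A] Metric_space.commute[OF B] by (auto split: sum.split)
  assume u: "u \<in> A <+> B" and v: "v \<in> A <+> B"
  then show "(case u of Inl a \<Rightarrow> (case v of Inl a' \<Rightarrow> dA a a' | Inr b \<Rightarrow> r)
    | Inr b \<Rightarrow> (case v of Inl a \<Rightarrow> r | Inr b' \<Rightarrow> dB b b')) = 0 \<longleftrightarrow> u = v"
    using Metric_space.zero[OF A] Metric_space.zero[OF B] r by (auto split: sum.split)
  assume w: "w \<in> A <+> B"
  show "(case u of Inl a \<Rightarrow> (case w of Inl a' \<Rightarrow> dA a a' | Inr b \<Rightarrow> r)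
      | Inr b \<Rightarrow> (case w of Inl a \<Rightarrow> r | Inr b' \<Rightarrow> dB b b'))
    \<le> (case u of Inl a \<Rightarrow> (case v of Inl a' \<Rightarrow> dA a a' | Inr b \<Rightarrow> r)
      | Inr b \<Rightarrow> (case v of Inl a \<Rightarrow> r | Inr b' \<Rightarrow> dB b b'))
    + (case v of Inl a \<Rightarrow> (case w of Inl a' \<Rightarrow> dA a a' | Inr b \<Rightarrow> r)
      | Inr b \<Rightarrow> (case w of Inl a \<Rightarrow> r | Inr b' \<Rightarrow> dB b b'))"
    using u v w tri nn r bA bB by (cases u; cases v; cases w) force+
qed

lemma gh_distance_geI:
  assumes A: "Metric_space A dA" "A \<noteq> {}" and B: "Metric_space B dB" "B \<noteq> {}"
    and bA: "\<And>x y. x \<in> A \<Longrightarrow> y \<in> A \<Longrightarrow> dA x y \<le> M"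
    and bB: "\<And>x y. x \<in> B \<Longrightarrow> y \<in> B \<Longrightarrow> dB x y \<le> M"
    and far: "\<And>d. Metric_space (A <+> B) d \<Longrightarrow>
      (\<And>a a'. a \<in> A \<Longrightarrow> a' \<in> A \<Longrightarrow> d (Inl a) (Inl a') = dA a a') \<Longrightarrow>
      (\<And>b b'. b \<in> B \<Longrightarrow> b' \<in> B \<Longrightarrow> d (Inr b) (Inr b') = dB b b') \<Longrightarrow>
      (\<And>a. a \<in> A \<Longrightarrow> \<exists>b\<in>B. d (Inl a) (Inr b) < e) \<Longrightarrow>
      (\<And>b. b \<in> B \<Longrightarrow> \<exists>a\<in>A. d (Inl a) (Inr b) < e) \<Longrightarrow> False"
  shows "e \<le> gh_distance A dA B dB"
  unfolding gh_distance_def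
proof (rule cInf_greatest)
  define r where "r = max 1 (M / 2)"
  have r: "0 < r" "M \<le> 2 * r" by (auto simp: r_def)
  have "Metric_space (A <+> B) (\<lambda>u v. case u of
      Inl a \<Rightarrow> (case v of Inl a' \<Rightarrow> dA a a' | Inr b \<Rightarrow> r)
    | Inr b \<Rightarrow> (case v of Inl a \<Rightarrow> r | Inr b' \<Rightarrow> dB b b'))"
    by (rule Metric_space_Plus[OF A(1) B(1) r(1)]) (use bA bB r in force)+
  then show "{hausdorff_distance d (Inl ` A) (Inr ` B) |d.
     Metric_space (A <+> B) d \<and>
     (\<forall>a\<in>A. \<forall>a'\<in>A. d (Inl a) (Inl a') = dA a a') \<and>
     (\<forall>b\<in>B. \<forall>b'\<in>B. d (Inr b) (Inr b') = dB b b')} \<noteq> {}"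
    by (auto intro!: exI)
next
  fix D assume "D \<in> {hausdorff_distance d (Inl ` A) (Inr ` B) |d.
     Metric_space (A <+> B) d \<and>
     (\<forall>a\<in>A. \<forall>a'\<in>A. d (Inl a) (Inl a') = dA a a') \<and>
     (\<forall>b\<in>B. \<forall>b'\<in>B. d (Inr b) (Inr b') = dB b b')}"
  then obtain d where D: "D = hausdorff_distance d (Inl ` A) (Inr ` B)"
    and d: "Metric_space (A <+> B) d"
    and dA: "\<And>a a'. a \<in> A \<Longrightarrow> a' \<in> A \<Longrightarrow> d (Inl a) (Inl a') = dA a a'"
    and dB: "\<And>b b'. b \<in> B \<Longrightarrow> b' \<in> B \<Longrightarrow> d (Inr b) (Inr b') = dB b b'" by blast
  show "e \<le> D"
  proof (rule ccontr)
    assume "\<not> e \<le> D"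
    then have less: "hausdorff_distance d (Inl ` A) (Inr ` B) < e" using D by simp
    obtain a0 b0 where ab: "a0 \<in> A" "b0 \<in> B" using A B by blast
    \<comment> \<open>Cross distances are bounded by going through the fixed pair \<open>a0\<close>,
      \<open>b0\<close>, as both pieces have diameter at most \<open>M\<close>.\<close>
    have bd: "0 \<le> d u v \<and> d u v \<le> M + d (Inl a0) (Inr b0) + M"
      if "u \<in> Inl ` A" "v \<in> Inr ` B" for u v
    proof -
      obtain a b where uv: "u = Inl a" "v = Inr b" "a \<in> A" "b \<in> B" using \<open>u \<in> _\<close> \<open>v \<in> _\<close> by blast
      have "d u v \<le> d u (Inl a0) + d (Inl a0) v" "d (Inl a0) v \<le> d (Inl a0) (Inr b0) + d (Inr b0) v"
        using Metric_space.triangle[OF d] uv ab by auto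
      moreover have "d u (Inl a0) \<le> M" "d (Inr b0) v \<le> M" using uv ab dA dB bA bB by auto
      ultimately show ?thesis using Metric_space.nonneg[OF d] by auto
    qed
    show False
    proof (rule far[OF d dA dB])
      show "\<exists>b\<in>B. d (Inl a) (Inr b) < e" if "a \<in> A" for a
        using hausdorff_distance_less(1)[OF less _ _ bd, of "Inl a"] A B that by auto
      show "\<exists>a\<in>A. d (Inl a) (Inr b) < e" if "b \<in> B" for b
        using hausdorff_distance_less(2)[OF less _ _ bd, of "Inr b"] A B that by auto
    qed
  qed
qed

section \<open>Midpoints in the word metric\<close>

lemma pole_in_GZ:
  fixes k :: int
  assumes "\<bar>c\<bar> = 1"
  shows "(real_of_int k, 0, 0, c * real n) \<in> GZ"
proof -
  have "c = 1 \<or> c = - 1" using assms by linarith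
  then show ?thesis
    using central_in_heisenberg_int[of n]
      subgroup.m_inv_closed[OF heisenberg_int_subgroup central_in_heisenberg_int[of n]]
    by (auto simp: GZ_def)
qed

lemma pole_in_ball:
  assumes "\<bar>a\<bar> = 1" "\<bar>c\<bar> = 1"
  shows "(a * real n, 0, 0, c * real n) \<in> rho1_ball n"
proof -
  have ac: "a = 1 \<or> a = - 1" "c = 1 \<or> c = - 1" using assms by linarith+
  then have "(a, 0, 0, c) \<in> S1" by (auto simp: S1_eq)
  from reach_power_gen[OF this, of n]
  have "rho1 (0, 0, 0, 0) (a * real n, 0, 0, c * real n) \<le> real n"
    by (intro rho1_le) (simp add: mult.commute)
  moreover have "(a * real n, 0, 0, c * real n) \<in> GZ"
    using pole_in_GZ[OF assms(2), of "int n" n] pole_in_GZ[OF assms(2), of "- int n" n] ac by auto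
  ultimately show ?thesis by (simp add: rho1_ball_def)
qed

lemma rho1_ge_fst:
  assumes "(v, p) \<in> GZ" "(v', p') \<in> GZ"
  shows "\<bar>v' - v\<bar> \<le> rho1 (v, p) (v', p')"
proof -
  obtain k where k: "rho1 (v, p) (v', p') = real k" "reach k (inv\<^bsub>RH3\<^esub> (v, p) \<otimes>\<^bsub>RH3\<^esub> (v', p'))"
    using rho1_reach assms by blast
  then have "\<exists>x y z. reach k (v' - v, x, y, z)" by (cases p; cases p') auto
  then obtain x y z where "reach k (v' - v, x, y, z)" by blast
  from reach_bounds[OF this] show ?thesis using k by force
qed

text \<open>
  A central displacement of \<open>2 n\<close> needs a word enclosing area of order \<open>n\<close>, or \<open>n\<close> letters
  moving the first coordinate.
\<close>

lemma rho1_poles: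
  assumes "1 \<le> n"
  shows "sqrt (real n) \<le> rho1 (real n, 0, 0, real n) (real n, 0, 0, - real n)"
proof -
  have "(real n, 0, 0, real n) \<in> GZ" "(real n, 0, 0, - real n) \<in> GZ"
    using pole_in_GZ[of 1 "int n" n] pole_in_GZ[of "-1" "int n" n] by auto
  then obtain k where k: "rho1 (real n, 0, 0, real n) (real n, 0, 0, - real n) = real k"
    "reach k (inv\<^bsub>RH3\<^esub> (real n, 0, 0, real n) \<otimes>\<^bsub>RH3\<^esub> (real n, 0, 0, - real n))"
    using rho1_reach by blast
  then have "reach k (0, 0, 0, - 2 * real n)" by simp
  from reach_bounds[OF this] obtain V H where VH: "0 \<le> V" "0 \<le> H" "V + H = real k"
    "\<bar>- 2 * real n\<bar> \<le> V + H ^ 2" by blast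
  have "H ^ 2 \<le> real k ^ 2" using VH by (intro power_mono) auto
  \<comment> \<open>Since \<open>k\<close> is an integer, 2 n is at most V + H^2, hence at most k +
    k^2, hence at most 2 k^2.\<close>
  moreover have "real k \<le> real k ^ 2" by (cases k) (auto simp: power2_eq_square)
  ultimately have "real n \<le> real k ^ 2" using VH by linarith
  then show ?thesis using k(1) real_le_lsqrt by simp
qed

text \<open>The first coordinate must advance by 2 n in at most 2 n + 2 D letters, so at most 2 D
  letters are horizontal. Central displacement then comes almost only from the letters (1; 0, 0, c)
  and their like, which bounds \<open>z\<close> from both sides.\<close>

lemma rho1_midpoint:
  fixes n D :: nat
  assumes m: "m \<in> GZ" and c: "\<bar>c\<bar> = 1"
    and le1: "rho1 (- real n, 0, 0, - (c * real n)) m \<le> real n + real D"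
    and le2: "rho1 m (real n, 0, 0, c * real n) \<le> real n + real D"
  shows "rho1 (0, 0, 0, 0) m \<le> 27 * real D"
proof -
  obtain t x y z where m_eq: "m = (t, x, y, z)" by (metis prod_cases4)
  have p: "(- real n, 0, 0, - (c * real n)) \<in> GZ" and q: "(real n, 0, 0, c * real n) \<in> GZ"
    using pole_in_GZ[of "- c" "- int n" n] pole_in_GZ[of c "int n" n] c by auto
  obtain k where k: "rho1 (- real n, 0, 0, - (c * real n)) m = real k"
    "reach k (inv\<^bsub>RH3\<^esub> (- real n, 0, 0, - (c * real n)) \<otimes>\<^bsub>RH3\<^esub> m)"
    using rho1_reach[OF p m] by blast
  have "reach k (real n + t, x, y, c * real n + z)" using k(2) by (simp add: m_eq)
  from reach_bounds[OF this] obtain V H where VH: "0 \<le> V" "0 \<le> H" "V + H = real k"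
    "\<bar>real n + t\<bar> \<le> V" "\<bar>x\<bar> + \<bar>y\<bar> \<le> H" "\<bar>c * real n + z\<bar> \<le> V + H ^ 2" by blast
  obtain l where l: "rho1 m (real n, 0, 0, c * real n) = real l"
    "reach l (inv\<^bsub>RH3\<^esub> m \<otimes>\<^bsub>RH3\<^esub> (real n, 0, 0, c * real n))"
    using rho1_reach[OF m q] by blast
  have "reach l (real n - t, - x, - y, c * real n - z)" using l(2) by (simp add: m_eq)
  from reach_bounds[OF this] obtain V' H' where VH': "0 \<le> V'" "0 \<le> H'" "V' + H' = real l"
    "\<bar>real n - t\<bar> \<le> V'" "\<bar>c * real n - z\<bar> \<le> V' + H' ^ 2" by blast
  have kl: "real k \<le> real n + real D" "real l \<le> real n + real D" using k l le1 le2 by auto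
  have "2 * real n \<le> V + V'" using VH(4) VH'(4) by linarith
  then have HD: "H \<le> 2 * real D" "H' \<le> 2 * real D" using VH(2,3) VH'(2,3) kl by linarith+
  then have sq: "H ^ 2 \<le> 4 * real D ^ 2" "H' ^ 2 \<le> 4 * real D ^ 2"
    using power_mono[OF HD(1) VH(2), of 2] power_mono[OF HD(2) VH'(2), of 2]
    by (auto simp: power_mult_distrib)
  have t: "\<bar>t\<bar> \<le> real D"
    using VH(2-4) VH'(2-4) kl by linarith
  have V: "V \<le> real n + real D" "V' \<le> real n + real D" using VH(2,3) VH'(2,3) kl by linarith+
  \<comment> \<open>The two words bound \<open>c * real n + z\<close> and
    \<open>c * real n - z\<close> by nearly \<open>real n\<close>. As \<open>c\<close> is a sign,
    one gives the upper and the other the lower bound on \<open>z\<close>.\<close>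
  have "c = 1 \<or> c = - 1" using c by linarith
  then have z: "\<bar>z\<bar> \<le> real D + 4 * real D ^ 2"
    using VH(6) VH'(5) sq V by auto
  have xy: "\<bar>x\<bar> \<le> 2 * real D" "\<bar>y\<bar> \<le> 2 * real D" "\<bar>x\<bar> + \<bar>y\<bar> \<le> 2 * real D"
    using VH(5) HD by linarith+
  have "\<bar>x * y\<bar> \<le> (2 * real D) * (2 * real D)"
    unfolding abs_mult using xy by (intro mult_mono) auto
  then have "\<bar>x * y / 2\<bar> \<le> 2 * real D ^ 2" by (simp add: power2_eq_square)
  moreover have "\<bar>z - x * y / 2 - t\<bar> \<le> \<bar>z\<bar> + \<bar>x * y / 2\<bar> + \<bar>t\<bar>"
    using abs_triangle_ineq4[of "z - x * y / 2" t] abs_triangle_ineq4[of z "x * y / 2"] by linarith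
  moreover have "real D \<le> real D ^ 2" by (cases D) (auto simp: power2_eq_square)
  \<comment> \<open>The remaining central exponent is at most D + 4 D^2 + 2 D^2 + D, hence at most 8
    D^2, and 3 D is a convenient integer root. The length is then at most D + 2 D + 24 D.\<close>
  moreover have "real (3 * D) ^ 2 = 9 * real D ^ 2" by (simp add: power_mult_distrib)
  ultimately have "\<bar>z - x * y / 2 - t\<bar> \<le> real (3 * D) ^ 2" using z t by argo
  then obtain j where j: "real j \<le> \<bar>t\<bar> + \<bar>x\<bar> + \<bar>y\<bar> + 8 * real (3 * D)" "reach j m"
    using GZ_reach m unfolding m_eq by blast
  have "rho1 (0, 0, 0, 0) m \<le> real j" by (rule rho1_le) (use j(2) in \<open>simp add: m_eq\<close>)
  then show ?thesis using j(1) t xy by simp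
qed

lemma rho1_ball_metric:
  assumes "1 \<le> n"
  shows "Metric_space (rho1_ball n) (\<lambda>g h. rho1 g h / real n)"
proof -
  interpret Metric_space "rho1_ball n" rho1
    by (rule Metric_space.subspace[OF rho1_metric]) (auto simp: rho1_ball_def)
  show ?thesis
    by standard (use assms triangle in \<open>auto simp: commute divide_right_mono simp flip: add_divide_distrib\<close>)
qed

lemma id_in_rho1_ball: "(0, 0, 0, 0) \<in> rho1_ball n"
proof -
  have "(0, 0, 0, 0) \<in> GZ" using subgroup.one_closed[OF GZ_subgroup] by simp
  moreover from this have "rho1 (0, 0, 0, 0) (0, 0, 0, 0) = 0" using Metric_space.zero[OF rho1_metric] by blast
  ultimately show ?thesis by (simp add: rho1_ball_def)
qed

lemma id_in_d_inf_ball: "(0, 0, 0, 0) \<in> d_inf_ball 1"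
  using d3_eq_0_iff[of "(0, 0, 0)" "(0, 0, 0)"] by (simp add: d_inf_ball_iff)

section \<open>Transfer along a correspondence\<close>

lemma (in Metric_space) triangle_4:
  "x \<in> M \<Longrightarrow> y \<in> M \<Longrightarrow> z \<in> M \<Longrightarrow> w \<in> M \<Longrightarrow> d x w \<le> d x y + (d y z + d z w)"
  using triangle[of x y w] triangle[of y z w] by simp

text \<open>
  The constant 164 is \<open>2 (1 + 81)\<close>: a point \<open>m'\<close> matched with an \<open>e\<close>-midpoint in the limit is a
  \<open>3 e\<close>-midpoint in the word metric, hence within \<open>27 \<cdot> 3 e\<close> of the identity;
  this is used for \<open>m'\<close> and for the point matched with the identity of the limit.
\<close>

lemma pole_correspondence:
  fixes n :: nat and e c :: real
  defines "p \<equiv> (- real n, 0, 0, - (c * real n))" and "q \<equiv> (real n, 0, 0, c * real n)"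
  assumes n: "1 \<le> n" and c: "\<bar>c\<bar> = 1" and e: "0 < e" "e \<le> 1 / 10 ^ 7"
    and d: "Metric_space (rho1_ball n <+> d_inf_ball 1) d"
    and dA: "\<And>g h. g \<in> rho1_ball n \<Longrightarrow> h \<in> rho1_ball n \<Longrightarrow> d (Inl g) (Inl h) = rho1 g h / real n"
    and dB: "\<And>g h. g \<in> d_inf_ball 1 \<Longrightarrow> h \<in> d_inf_ball 1 \<Longrightarrow> d (Inr g) (Inr h) = d_inf g h"
    and near: "\<And>g. g \<in> rho1_ball n \<Longrightarrow> \<exists>h\<in>d_inf_ball 1. d (Inl g) (Inr h) < e"
    and near': "\<And>h. h \<in> d_inf_ball 1 \<Longrightarrow> \<exists>g\<in>rho1_ball n. d (Inl g) (Inr h) < e"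
  shows "\<exists>s g s' g'. (s, g) \<in> d_inf_ball 1 \<and> (s', g') \<in> d_inf_ball 1 \<and>
    d (Inl p) (Inr (s, g)) < e \<and> d (Inl q) (Inr (s', g')) < e \<and>
    d3 (0, 0, 0) g < 164 * e \<and> d3 (0, 0, 0) g' < 164 * e"
proof -
  interpret Metric_space "rho1_ball n <+> d_inf_ball 1" d by (rule d)
  have GZ: "g \<in> GZ" if "g \<in> rho1_ball n" for g using that by (simp add: rho1_ball_def)
  have pq: "p \<in> rho1_ball n" "q \<in> rho1_ball n"
    using pole_in_ball[of "-1" "- c" n] pole_in_ball[of 1 c n] c by (auto simp: p_def q_def)
  obtain s g where p': "(s, g) \<in> d_inf_ball 1" "d (Inl p) (Inr (s, g)) < e"
    using near[OF pq(1)] by (metis surj_pair)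
  obtain s' g' where q': "(s', g') \<in> d_inf_ball 1" "d (Inl q) (Inr (s', g')) < e"
    using near[OF pq(2)] by (metis surj_pair)
  have n0: "0 < real n" using n by simp
  have "2 * real n \<le> rho1 p q"
    using rho1_ge_fst GZ[OF pq(1)] GZ[OF pq(2)] unfolding p_def q_def by fastforce
  then have "2 \<le> d (Inl p) (Inl q)" using dA pq n0 by (simp add: le_divide_eq)
  also have "\<dots> \<le> d (Inl p) (Inr (s, g)) + (d (Inr (s, g)) (Inr (s', g')) + d (Inr (s', g')) (Inl q))"
    using triangle_4[of "Inl p" "Inr (s, g)" "Inr (s', g')" "Inl q"] pq p'(1) q'(1)
        by (simp add: InlI InrI)
  finally have far: "2 - 2 * e \<le> d_inf (s, g) (s', g')"
    using p' q' dB commute[of "Inr (s', g')" "Inl q"] by simp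
  have lift: "\<exists>g\<in>rho1_ball n. d (Inl g) (Inr m) < e \<and> d (Inl g) (Inl (0, 0, 0, 0)) \<le> 81 * e"
    if m: "m \<in> d_inf_ball 1" "d_inf (s, g) m \<le> 1 + e" "d_inf m (s', g') \<le> 1 + e" for m
  proof -
    obtain m' where m': "m' \<in> rho1_ball n" "d (Inl m') (Inr m) < e" using near' m by blast
    \<comment> \<open>Word lengths are integers, so an excess of at most
      \<open>3 * e * real n\<close> over \<open>n\<close> may be rounded down without loss.\<close>
    define D where "D = nat \<lfloor>3 * e * real n\<rfloor>"
    have D: "real D \<le> 3 * e * real n" using e n0 by (simp add: D_def)
    have round: "r \<le> real n + real D" if "r / real n < 1 + 3 * e" "r = real k" for r k
    proof -
      have "r < real n + 3 * e * real n" using that(1) n0 by (simp add: divide_less_eq algebra_simps)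
      then have "of_int (int k - int n) \<le> 3 * e * real n" using that(2) by simp
      then have "int k - int n \<le> \<lfloor>3 * e * real n\<rfloor>" by (simp only: le_floor_iff)
      then show ?thesis using that(2) unfolding D_def by linarith
    qed
    have "d (Inl p) (Inl m') \<le> d (Inl p) (Inr (s, g)) + (d (Inr (s, g)) (Inr m) + d (Inr m) (Inl m'))"
      using triangle_4[of "Inl p" "Inr (s, g)" "Inr m" "Inl m'"] pq p'(1) m(1) m'(1)
        by (simp add: InlI InrI)
    then have "rho1 p m' / real n < 1 + 3 * e"
      using p' m m' dA pq dB commute[of "Inr m" "Inl m'"] by simp
    then have le1: "rho1 p m' \<le> real n + real D"
      using round rho1_reach[OF GZ GZ, OF pq(1) m'(1)] by blast
    have "d (Inl m') (Inl q) \<le> d (Inl m') (Inr m) + (d (Inr m) (Inr (s', g')) + d (Inr (s', g')) (Inl q))"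
      using triangle_4[of "Inl m'" "Inr m" "Inr (s', g')" "Inl q"] pq q'(1) m(1) m'(1)
        by (simp add: InlI InrI)
    then have "rho1 m' q / real n < 1 + 3 * e"
      using q' m m' dA pq dB commute[of "Inr (s', g')" "Inl q"] by simp
    then have le2: "rho1 m' q \<le> real n + real D"
      using round rho1_reach[OF GZ GZ, OF m'(1) pq(2)] by blast
    have "rho1 (0, 0, 0, 0) m' \<le> 27 * real D"
      using rho1_midpoint[OF GZ[OF m'(1)] c] le1 le2 unfolding p_def q_def by simp
    then have "rho1 (0, 0, 0, 0) m' \<le> 81 * e * real n" using D by simp
    then have "d (Inl (0, 0, 0, 0)) (Inl m') \<le> 81 * e"
      using dA id_in_rho1_ball m'(1) n0 by (simp add: divide_le_eq)
    then show ?thesis using m' commute[of "Inl (0, 0, 0, 0)" "Inl m'"] by auto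
  qed
  have in1: "\<bar>s\<bar> + d3 (0, 0, 0) g \<le> 1" "\<bar>s'\<bar> + d3 (0, 0, 0) g' \<le> 1"
    using p' q' by (auto simp: d_inf_ball_iff)
  \<comment> \<open>The identity of the limit is itself an approximate midpoint, because both
    endpoints lie in the unit ball. Its partner \<open>i\<close> is therefore close to the identity
    of the lattice.\<close>
  have "d_inf (s, g) (0, 0, 0, 0) \<le> 1 + e" "d_inf (0, 0, 0, 0) (s', g') \<le> 1 + e"
    using in1 e d3_sym[of g "(0, 0, 0)"] by (auto simp: d_inf_eq)
  then obtain i where i: "i \<in> rho1_ball n" "d (Inl i) (Inr (0, 0, 0, 0)) < e"
      "d (Inl i) (Inl (0, 0, 0, 0)) \<le> 81 * e"
    using lift[OF id_in_d_inf_ball] by blast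
  have mid: "d_inf (0, 0, 0, 0) m < 164 * e"
    if m: "m \<in> d_inf_ball 1" "d_inf (s, g) m \<le> 1 + e" "d_inf m (s', g') \<le> 1 + e" for m
  proof -
    obtain m' where m': "m' \<in> rho1_ball n" "d (Inl m') (Inr m) < e"
      "d (Inl m') (Inl (0, 0, 0, 0)) \<le> 81 * e" using lift[OF m] by blast
    let ?o = "(0, 0, 0, 0) :: real \<times> real \<times> real \<times> real"
    have "d (Inr ?o) (Inr m) \<le> d (Inr ?o) (Inl i) + d (Inl i) (Inl ?o) + d (Inl ?o) (Inl m')
        + d (Inl m') (Inr m)"
      using triangle[of "Inr ?o" "Inl i" "Inr m"] triangle[of "Inl i" "Inl ?o" "Inr m"]
        triangle[of "Inl ?o" "Inl m'" "Inr m"] m(1) m'(1) i(1) id_in_d_inf_ball id_in_rho1_ball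
      by (simp add: InlI InrI)
    then have "d (Inr ?o) (Inr m) < 164 * e"
      using i m' e commute[of "Inr ?o" "Inl i"] commute[of "Inl ?o" "Inl m'"] by simp
    then show ?thesis using dB[OF id_in_d_inf_ball m(1)] by simp
  qed
  \<comment> \<open>Here the linear error in \<open>e\<close> is beaten by the square-root
    displacement of the midpoint: 164^2 = 26896, and \<open>e\<close> at most 1 / 10^7 makes 26896 e
    at most 1 / 128.\<close>
  have "(164 * e) ^ 2 \<le> e / 128"
  proof -
    have "e * (26896 * e) \<le> e * (1 / 128)" using e by (intro mult_left_mono) auto
    then show ?thesis by (simp add: power2_eq_square)
  qed
  then have "164 * e \<le> sqrt (e / 128)" by (rule real_le_rsqrt)
  then have "d3 (0, 0, 0) g < 164 * e \<and> d3 (0, 0, 0) g' < 164 * e"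
    using e by (intro d_inf_unique_midpoint[OF p'(1) q'(1) far mid]) auto
  then show ?thesis using p' q' by blast
qed

section \<open>The contradiction between the two poles with equal first coordinate\<close>

theorem proposition5p2:
  shows "\<exists>c>0. \<forall>n::nat. 1 \<le> n \<longrightarrow>
    gh_distance (rho1_ball n) (\<lambda>g h. rho1 g h / real n) (d_inf_ball 1) d_inf > c / sqrt (real n)"
proof (intro exI[of _ "1 / 10 ^ 8 :: real"] conjI allI impI)
  show "0 < (1 / 10 ^ 8 :: real)" by simp
next
  fix n :: nat assume n: "1 \<le> n"
  \<comment> \<open>This is ten times the claimed bound, so the non-strict estimate for
    \<open>e\<close> gives the strict one.\<close>
  define e where "e = 1 / 10 ^ 7 / sqrt (real n)"
  have rt: "1 \<le> sqrt (real n)" using n by simp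
  then have e: "0 < e" "e \<le> 1 / 10 ^ 7" by (auto simp: e_def divide_le_eq)
  have A: "Metric_space (rho1_ball n) (\<lambda>g h. rho1 g h / real n)" by (rule rho1_ball_metric[OF n])
  have B: "Metric_space (d_inf_ball 1) d_inf"
    by (rule Metric_space.subspace[OF d_inf_metric]) simp
  have "e \<le> gh_distance (rho1_ball n) (\<lambda>g h. rho1 g h / real n) (d_inf_ball 1) d_inf"
  proof (rule gh_distance_geI[OF A _ B])
    show "rho1_ball n \<noteq> {}" "d_inf_ball 1 \<noteq> {}" using id_in_rho1_ball id_in_d_inf_ball by blast+
    show "rho1 g h / real n \<le> 2" if "g \<in> rho1_ball n" "h \<in> rho1_ball n" for g h
    proof -
      have "rho1 g h \<le> rho1 g (0, 0, 0, 0) + rho1 (0, 0, 0, 0) h"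
        using Metric_space.triangle[OF rho1_metric] that id_in_rho1_ball by (auto simp: rho1_ball_def)
      then have "rho1 g h \<le> 2 * real n"
        using that Metric_space.commute[OF rho1_metric, of g] by (auto simp: rho1_ball_def)
      then show ?thesis using n by (simp add: divide_le_eq)
    qed
    show "d_inf g h \<le> 2" if "g \<in> d_inf_ball 1" "h \<in> d_inf_ball 1" for g h
      using Metric_space.triangle[OF d_inf_metric, of g "(0, 0, 0, 0)" h] that
        Metric_space.commute[OF d_inf_metric, of g] by (auto simp: d_inf_ball_def)
  next
    fix d assume d: "Metric_space (rho1_ball n <+> d_inf_ball 1) d"
      and dA: "\<And>g h. g \<in> rho1_ball n \<Longrightarrow> h \<in> rho1_ball n \<Longrightarrow> d (Inl g) (Inl h) = rho1 g h / real n"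
      and dB: "\<And>g h. g \<in> d_inf_ball 1 \<Longrightarrow> h \<in> d_inf_ball 1 \<Longrightarrow> d (Inr g) (Inr h) = d_inf g h"
      and near: "\<And>g. g \<in> rho1_ball n \<Longrightarrow> \<exists>h\<in>d_inf_ball 1. d (Inl g) (Inr h) < e"
      and near': "\<And>h. h \<in> d_inf_ball 1 \<Longrightarrow> \<exists>g\<in>rho1_ball n. d (Inl g) (Inr h) < e"
    interpret Metric_space "rho1_ball n <+> d_inf_ball 1" d by (rule d)
    let ?p = "(- real n, 0, 0, - real n)" and ?q = "(real n, 0, 0, real n)"
      and ?q' = "(real n, 0, 0, - real n)"
    have corr: "\<exists>s g s' g'. (s, g) \<in> d_inf_ball 1 \<and> (s', g') \<in> d_inf_ball 1 \<and>
      d (Inl (- real n, 0, 0, - (c * real n))) (Inr (s, g)) < e \<and>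
      d (Inl (real n, 0, 0, c * real n)) (Inr (s', g')) < e \<and>
      d3 (0, 0, 0) g < 164 * e \<and> d3 (0, 0, 0) g' < 164 * e" if "\<bar>c\<bar> = 1" for c
      by (rule pole_correspondence[OF n that e d]) (fact dA dB near near')+
    obtain s g s1 g1 where 1: "(s, g) \<in> d_inf_ball 1" "(s1, g1) \<in> d_inf_ball 1"
      "d (Inl ?p) (Inr (s, g)) < e" "d (Inl ?q) (Inr (s1, g1)) < e"
      "d3 (0, 0, 0) g < 164 * e" "d3 (0, 0, 0) g1 < 164 * e"
      using corr[of 1] by (simp only: mult_1 abs_one) blast
    obtain s2 g2 where 2: "(s2, g2) \<in> d_inf_ball 1"
      "d (Inl ?q') (Inr (s2, g2)) < e" "d3 (0, 0, 0) g2 < 164 * e"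
      using corr[of "- 1"] by (simp only: mult_minus1 abs_minus_cancel abs_one) blast
    have ball: "?p \<in> rho1_ball n" "?q \<in> rho1_ball n" "?q' \<in> rho1_ball n"
      using pole_in_ball[of "-1" "-1" n] pole_in_ball[of 1 1 n] pole_in_ball[of 1 "-1" n] by auto
    have tri: "d3 f f' < 328 * e" if "d3 (0, 0, 0) f < 164 * e" "d3 (0, 0, 0) f' < 164 * e" for f f'
      using d3_triangle[of f f' "(0, 0, 0)"] d3_sym[of f "(0, 0, 0)"] that by simp
    \<comment> \<open>The single negative pole \<open>?p\<close> serves as reference for both
      \<open>?q\<close> and \<open>?q'\<close>: each is at distance at least 2 from it. Passing to
      the limit points loses \<open>2 * e\<close>, and the Heisenberg parts account for at most
      \<open>328 * e\<close>.\<close>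
    have opposite: "2 - 330 * e \<le> \<bar>s' - s\<bar>"
      if q: "(real n, r) \<in> rho1_ball n" and q': "(s', g') \<in> d_inf_ball 1"
        "d (Inl (real n, r)) (Inr (s', g')) < e" "d3 (0, 0, 0) g' < 164 * e" for r s' g'
    proof -
      have "2 * real n \<le> rho1 ?p (real n, r)"
        using rho1_ge_fst[of "- real n" "(0, 0, - real n)" "real n" r] ball q by (simp add: rho1_ball_def)
      then have "2 \<le> d (Inl ?p) (Inl (real n, r))" using dA[OF ball(1) q] n by (simp add: le_divide_eq)
      also have "\<dots> \<le> d (Inl ?p) (Inr (s, g)) + (d (Inr (s, g)) (Inr (s', g'))
          + d (Inr (s', g')) (Inl (real n, r)))"
        using triangle_4[of "Inl ?p" "Inr (s, g)" "Inr (s', g')" "Inl (real n, r)"] ball(1) q q'(1) 1(1)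
        by (simp add: InlI InrI)
      finally show ?thesis
        using 1 q' dB[OF 1(1) q'(1)] tri[OF 1(5) q'(3)] commute[of "Inr (s', g')" "Inl (real n, r)"]
        by (simp add: d_inf_eq)
    qed
    have fst_le: "\<bar>t\<bar> \<le> 1" if "(t, f) \<in> d_inf_ball 1" for t f
      using that d3_nonneg[of "(0, 0, 0)" f] by (simp add: d_inf_ball_iff)
    have "\<bar>s\<bar> \<le> 1" "\<bar>s1\<bar> \<le> 1" "\<bar>s2\<bar> \<le> 1"
      using 1 2 fst_le by blast+
    \<comment> \<open>All first coordinates lie in [-1, 1]. For \<open>e\<close> this small,
      \<open>s1\<close> and \<open>s2\<close> cannot lie on opposite sides of \<open>s\<close>, so
      both are within \<open>330 * e\<close> of the same end of the interval.\<close>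
    moreover have "e \<le> 1 / 1000" using e(2) by simp
    ultimately have "\<bar>s2 - s1\<bar> \<le> 330 * e"
      using opposite[OF ball(2) 1(2,4,6)] opposite[OF ball(3) 2] by linarith
    then have close: "d_inf (s1, g1) (s2, g2) < 658 * e" using tri[OF 1(6) 2(3)] by (simp add: d_inf_eq)
    have "d (Inl ?q) (Inl ?q') \<le> d (Inl ?q) (Inr (s1, g1))
        + (d (Inr (s1, g1)) (Inr (s2, g2)) + d (Inr (s2, g2)) (Inl ?q'))"
      using triangle_4[of "Inl ?q" "Inr (s1, g1)" "Inr (s2, g2)" "Inl ?q'"] ball 1 2
        by (simp add: InlI InrI)
    also have "\<dots> < 660 * e"
      using 1 2 close dB[OF 1(2) 2(1)] commute[of "Inr (s2, g2)" "Inl ?q'"] by simp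
    finally have "d (Inl ?q) (Inl ?q') < 660 * e" .
    moreover have "sqrt (real n) / real n \<le> d (Inl ?q) (Inl ?q')"
      using rho1_poles[OF n] dA[OF ball(2,3)] by (simp add: divide_right_mono)
    \<comment> \<open>The poles \<open>?q\<close> and \<open>?q'\<close> are thus at distance at
      least \<open>10 ^ 7 * e\<close>, but their limit partners place them within
      \<open>660 * e\<close>.\<close>
    moreover have "sqrt (real n) / real n = 10 ^ 7 * e"
      using rt by (simp add: e_def sqrt_divide_self_eq inverse_eq_divide)
    ultimately show False using e by simp
  qed
  moreover have "1 / 10 ^ 8 / sqrt (real n) = e / 10" by (simp add: e_def)
  ultimately show "1 / 10 ^ 8 / sqrt (real n) < gh_distance (rho1_ball n) (\<lambda>g h. rho1 g h / real n)
      (d_inf_ball 1) d_inf" using e(1) by simp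
qed

end
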